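(* Let $N_1,N_2$ be positive integers and let $R=(R^{\lambda\alpha}_{\beta\mu})$ be complex numbers satisfying the conditions (C1)-(C4) listed in the context. Let $\mathcal{A}_R^!$ be the Koszul dual quadratic algebra and $\mathcal{C}\ell(\mathcal{A}_R)$ the generalised Clifford algebra, filtered by the degree in the generators $\Gamma$, both as defined in the context. Then the canonical surjective homomorphism of graded algebras $$\mathrm{can}:\mathcal{A}_R^!\longrightarrow\mathrm{gr}(\mathcal{C}\ell(\mathcal{A}_R))=\bigoplus_{n\in\mathbb{N}}\mathcal{F}^n/\mathcal{F}^{n-1}$$ is an isomorphism of graded algebras.
   Context: Repeated up-down indices are summed; $\lambda,\mu,\nu,\rho,\dots$ run in $\{1,\dots,N_1\}$ and $\alpha,\beta,\gamma,\delta,\dots$ run in $\{1,\dots,N_2\}$; the bar is complex conjugation. Algebras are unital associative complex algebras. Conditions (for all values of the free indices): (C1) $\overline{R}^{\lambda\alpha}_{\beta\mu}R^{\mu\beta}_{\gamma\nu}=\delta^\lambda_\nu\delta^\alpha_\gamma$. (C2) $R^{\lambda\alpha}_{\gamma\rho}R^{\rho\beta}_{\delta\mu}=R^{\lambda\beta}_{\delta\rho}R^{\rho\alpha}_{\gamma\mu}$, $\ \overline{R}^{\lambda\alpha}_{\gamma\rho}\overline{R}^{\rho\beta}_{\delta\mu}=\overline{R}^{\lambda\beta}_{\delta\rho}\overline{R}^{\rho\alpha}_{\gamma\mu}$, $\ \overline{R}^{\lambda\alpha}_{\gamma\rho}R^{\rho\beta}_{\delta\mu}=R^{\lambda\beta}_{\delta\rho}\overline{R}^{\rho\alpha}_{\gamma\mu}$.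 (C3) $R^{\lambda\alpha}_{\gamma\nu}R^{\mu\gamma}_{\beta\rho}=R^{\mu\alpha}_{\gamma\rho}R^{\lambda\gamma}_{\beta\nu}$, $\ \overline{R}^{\lambda\alpha}_{\gamma\nu}\overline{R}^{\mu\gamma}_{\beta\rho}=\overline{R}^{\mu\alpha}_{\gamma\rho}\overline{R}^{\lambda\gamma}_{\beta\nu}$, $\ R^{\lambda\alpha}_{\gamma\nu}\overline{R}^{\mu\gamma}_{\beta\rho}=\overline{R}^{\mu\alpha}_{\gamma\rho}R^{\lambda\gamma}_{\beta\nu}$. (C4) $\sum_{\lambda,\beta}R^{\lambda\gamma}_{\beta\nu}R^{\lambda\beta}_{\alpha\mu}=\delta^\gamma_\alpha\delta_{\mu\nu}$ and $\sum_{\alpha,\rho}R^{\lambda\alpha}_{\beta\rho}R^{\rho\alpha}_{\gamma\mu}=\delta^\lambda_\mu\delta_{\beta\gamma}$. The algebra $\mathcal{A}_R$ is generated by $x_1^\lambda,x_2^\alpha$ with relations $x_1^\lambda x_1^\mu=x_1^\mu x_1^\lambda$, $x_2^\alpha x_2^\beta=x_2^\beta x_2^\alpha$, $x_1^\lambda x_2^\alpha=R^{\lambda\alpha}_{\beta\mu}x_2^\beta x_1^\mu$. Its Koszul dual $\mathcal{A}_R^!$ is the graded algebra generated by degree-one elements $\theta^1_\lambda,\theta^2_\alpha$ with relations $$\theta^1_\lambda\theta^1_\mu=-\theta^1_\mu\theta^1_\lambda,\quad\theta^2_\alpha\theta^2_\beta=-\theta^2_\beta\theta^2_\alpha,\quad\theta^2_\beta\theta^1_\mu=-R^{\lambda\alpha}_{\beta\mu}\theta^1_\lambda\theta^2_\alpha.$$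 The Clifford algebra $\mathcal{C}\ell(\mathcal{A}_R)$ is the algebra generated by $\Gamma^1_\lambda,\Gamma^2_\alpha$ with relations $$\Gamma^1_\lambda\Gamma^1_\mu+\Gamma^1_\mu\Gamma^1_\lambda=2\delta_{\lambda\mu}1,\quad\Gamma^2_\alpha\Gamma^2_\beta+\Gamma^2_\beta\Gamma^2_\alpha=2\delta_{\alpha\beta}1,\quad\Gamma^2_\beta\Gamma^1_\mu+R^{\lambda\alpha}_{\beta\mu}\Gamma^1_\lambda\Gamma^2_\alpha=0.$$ It is filtered by $\mathcal{F}^n=\{\text{elements of degree in }\Gamma\le n\}$ (with $\mathcal{F}^{-1}=0$), and $\mathrm{can}$ is the algebra homomorphism sending $\theta^1_\lambda$, $\theta^2_\alpha$ to the classes of $\Gamma^1_\lambda$, $\Gamma^2_\alpha$ in $\mathcal{F}^1/\mathcal{F}^0$. *)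

theory Defs
  imports Complex_Main "HOL-Algebra.QuotRing" "HOL-Algebra.Module" "HOL-Library.Poly_Mapping"
begin

section \<open>Free algebras and presented algebras\<close>

text \<open>Words form the free monoid on the letters, written additively because the convolution
  product on \<open>\<Rightarrow>\<^sub>0\<close> uses the additive structure of the index type.  The wrapper around lists keeps
  clear of other additive structures on lists.\<close>

datatype 'g fword = Word (letters: "'g list")

instantiation fword :: (type) monoid_add
begin

definition zero_fword :: "'g fword" where
  "zero_fword = Word []"

definition plus_fword :: "'g fword \<Rightarrow> 'g fword \<Rightarrow> 'g fword" where
  "plus_fword v w = Word (letters v @ letters w)"

instance
  by standard (auto simp: zero_fword_def plus_fword_def)

end

definition wlen :: "'g fword \<Rightarrow> nat" where
  "wlen w = length (letters w)"

type_synonym 'g free = "'g fword \<Rightarrow>\<^sub>0 complex"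

definition gen :: "'g \<Rightarrow> 'g free" where
  "gen g = Poly_Mapping.single (Word [g]) 1"

definition scal :: "complex \<Rightarrow> 'g free \<Rightarrow> 'g free" where
  "scal c x = Poly_Mapping.map (\<lambda>z. c * z) x"

text \<open>Associative algebras over the complex numbers are given as \<^typ>\<open>(complex, 'm) module\<close> records:
  a ring record together with a scalar multiplication.\<close>

definition free_alg :: "(complex, 'g free) module" where
  "free_alg = \<lparr>carrier = UNIV, mult = (*), one = 1, zero = 0, add = (+), smult = scal\<rparr>"

definition quot_alg :: "(complex, 'm) module \<Rightarrow> 'm set \<Rightarrow> (complex, 'm set) module" where
  "quot_alg A I = ring.extend (A Quot I)
     (module.fields (\<lambda>c X. \<Union>x\<in>X. I +>\<^bsub>A\<^esub> (c \<odot>\<^bsub>A\<^esub> x)))"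

text \<open>\<^const>\<open>genideal\<close> is the two-sided ideal; in the free algebra it is a complex subspace, since the
  scalars embed as multiples of the empty word.\<close>

definition presented_alg :: "'g free set \<Rightarrow> (complex, 'g free set) module" where
  "presented_alg S = quot_alg free_alg (Idl\<^bsub>free_alg\<^esub> S)"

definition cls :: "'g free set \<Rightarrow> 'g free \<Rightarrow> 'g free set" where
  "cls S x = (Idl\<^bsub>free_alg\<^esub> S) +>\<^bsub>free_alg\<^esub> x"

definition word_filtration :: "'g free set \<Rightarrow> nat \<Rightarrow> 'g free set set" where
  "word_filtration S n = cls S ` {x. \<forall>w\<in>Poly_Mapping.keys x. wlen w \<le> n}"

definition word_grading :: "'g free set \<Rightarrow> nat \<Rightarrow> 'g free set set" where
  "word_grading S n = cls S ` {x. \<forall>w\<in>Poly_Mapping.keys x. wlen w = n}"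


section \<open>Homomorphisms of algebras\<close>

definition alg_hom :: "(complex, 'm) module \<Rightarrow> (complex, 'n) module \<Rightarrow> ('m \<Rightarrow> 'n) \<Rightarrow> bool" where
  "alg_hom A B f \<longleftrightarrow> f \<in> ring_hom A B \<and>
     (\<forall>c. \<forall>x\<in>carrier A. f (c \<odot>\<^bsub>A\<^esub> x) = c \<odot>\<^bsub>B\<^esub> f x)"

definition graded_alg_iso ::
  "(complex, 'm) module \<Rightarrow> (nat \<Rightarrow> 'm set) \<Rightarrow> (complex, 'n) module \<Rightarrow> (nat \<Rightarrow> 'n set) \<Rightarrow>
     ('m \<Rightarrow> 'n) \<Rightarrow> bool" where
  "graded_alg_iso A GA B GB f \<longleftrightarrow>
     alg_hom A B f \<and> bij_betw f (carrier A) (carrier B) \<and> (\<forall>n. f ` GA n = GB n)"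


section \<open>The associated graded algebra of a filtered algebra\<close>

text \<open>\<open>filt_pred A F n\<close> is $F^{n-1}$, with the convention $F^{-1} = 0$.\<close>

definition filt_pred :: "(complex, 'm) module \<Rightarrow> (nat \<Rightarrow> 'm set) \<Rightarrow> nat \<Rightarrow> 'm set" where
  "filt_pred A F n = (case n of 0 \<Rightarrow> {\<zero>\<^bsub>A\<^esub>} | Suc m \<Rightarrow> F m)"

text \<open>The additive group $F^n/F^{n-1}$; HOL-Algebra writes the operation of such a quotient
  multiplicatively.\<close>

definition gr_comp :: "(complex, 'm) module \<Rightarrow> (nat \<Rightarrow> 'm set) \<Rightarrow> nat \<Rightarrow> 'm set monoid" where
  "gr_comp A F n = A_FactGroup (A\<lparr>carrier := F n\<rparr>) (filt_pred A F n)"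

text \<open>The product $F^m/F^{m-1} \times F^n/F^{n-1} \to F^{m+n}/F^{m+n-1}$ induced by that of \<open>A\<close>.\<close>

definition gr_comp_mult ::
  "(complex, 'm) module \<Rightarrow> (nat \<Rightarrow> 'm set) \<Rightarrow> nat \<Rightarrow> nat \<Rightarrow> 'm set \<Rightarrow> 'm set \<Rightarrow> 'm set" where
  "gr_comp_mult A F m n X Y = rcoset_mult A (filt_pred A F (m + n)) X Y"

definition gr_incl ::
  "(complex, 'm) module \<Rightarrow> (nat \<Rightarrow> 'm set) \<Rightarrow> nat \<Rightarrow> 'm \<Rightarrow> nat \<Rightarrow> 'm set" where
  "gr_incl A F n a = (\<lambda>k. if k = n then filt_pred A F n +>\<^bsub>A\<^esub> a else \<one>\<^bsub>gr_comp A F k\<^esub>)"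

text \<open>Elements of the direct sum are the finitely supported families of classes; \<open>gr_incl A F n a\<close>
  is the class of \<open>a\<close> placed in degree \<open>n\<close>.  In the product, \<^const>\<open>finprod\<close> is the sum over
  $i + j = n$ in $F^n/F^{n-1}$.\<close>

definition gr_alg ::
  "(complex, 'm) module \<Rightarrow> (nat \<Rightarrow> 'm set) \<Rightarrow> (complex, nat \<Rightarrow> 'm set) module" where
  "gr_alg A F = \<lparr>
     carrier = {x. (\<forall>n. x n \<in> carrier (gr_comp A F n)) \<and> finite {n. x n \<noteq> \<one>\<^bsub>gr_comp A F n\<^esub>}},
     mult = (\<lambda>x y n. finprod (gr_comp A F n) (\<lambda>i. gr_comp_mult A F i (n - i) (x i) (y (n - i))) {..n}),
     one = gr_incl A F 0 \<one>\<^bsub>A\<^esub>,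
     zero = (\<lambda>n. \<one>\<^bsub>gr_comp A F n\<^esub>),
     add = (\<lambda>x y n. x n \<otimes>\<^bsub>gr_comp A F n\<^esub> y n),
     smult = (\<lambda>c x n. \<Union>a\<in>x n. filt_pred A F n +>\<^bsub>A\<^esub> (c \<odot>\<^bsub>A\<^esub> a))\<rparr>"

definition gr_grading ::
  "(complex, 'm) module \<Rightarrow> (nat \<Rightarrow> 'm set) \<Rightarrow> nat \<Rightarrow> (nat \<Rightarrow> 'm set) set" where
  "gr_grading A F n = {x \<in> carrier (gr_alg A F). \<forall>k. k \<noteq> n \<longrightarrow> x k = \<one>\<^bsub>gr_comp A F k\<^esub>}"


section \<open>The conditions on R\<close>

text \<open>The index sets $\{1,\dots,N_1\}$ and $\{1,\dots,N_2\}$ are rendered as arbitrary finite types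
  \<open>'a\<close> and \<open>'b\<close> (nonempty, as all types), and $R^{\lambda\alpha}_{\beta\mu}$ is \<open>R l \<alpha> \<beta> \<mu>\<close>;
  \<open>l\<close> stands for the index $\lambda$.\<close>

type_synonym ('a, 'b) rmat = "'a \<Rightarrow> 'b \<Rightarrow> 'b \<Rightarrow> 'a \<Rightarrow> complex"

definition bar :: "('a, 'b) rmat \<Rightarrow> ('a, 'b) rmat" where
  "bar R l a b m = cnj (R l a b m)"

definition kron :: "'i \<Rightarrow> 'i \<Rightarrow> complex" where
  "kron i j = (if i = j then 1 else 0)"

definition cond_C1 :: "('a::finite, 'b::finite) rmat \<Rightarrow> bool" where
  "cond_C1 R \<longleftrightarrow> (\<forall>l \<alpha> \<gamma> \<nu>.
     (\<Sum>\<mu>\<in>UNIV. \<Sum>\<beta>\<in>UNIV. bar R l \<alpha> \<beta> \<mu> * R \<mu> \<beta> \<gamma> \<nu>) = kron l \<nu> * kron \<alpha> \<gamma>)"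

definition cond_C2 :: "('a::finite, 'b::finite) rmat \<Rightarrow> bool" where
  "cond_C2 R \<longleftrightarrow> (\<forall>l \<alpha> \<beta> \<gamma> \<delta> \<mu>.
     (\<Sum>\<rho>\<in>UNIV. R l \<alpha> \<gamma> \<rho> * R \<rho> \<beta> \<delta> \<mu>) = (\<Sum>\<rho>\<in>UNIV. R l \<beta> \<delta> \<rho> * R \<rho> \<alpha> \<gamma> \<mu>) \<and>
     (\<Sum>\<rho>\<in>UNIV. bar R l \<alpha> \<gamma> \<rho> * bar R \<rho> \<beta> \<delta> \<mu>) = (\<Sum>\<rho>\<in>UNIV. bar R l \<beta> \<delta> \<rho> * bar R \<rho> \<alpha> \<gamma> \<mu>) \<and>
     (\<Sum>\<rho>\<in>UNIV. bar R l \<alpha> \<gamma> \<rho> * R \<rho> \<beta> \<delta> \<mu>) = (\<Sum>\<rho>\<in>UNIV. R l \<beta> \<delta> \<rho> * bar R \<rho> \<alpha> \<gamma> \<mu>))"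

definition cond_C3 :: "('a::finite, 'b::finite) rmat \<Rightarrow> bool" where
  "cond_C3 R \<longleftrightarrow> (\<forall>l \<mu> \<nu> \<rho> \<alpha> \<beta>.
     (\<Sum>\<gamma>\<in>UNIV. R l \<alpha> \<gamma> \<nu> * R \<mu> \<gamma> \<beta> \<rho>) = (\<Sum>\<gamma>\<in>UNIV. R \<mu> \<alpha> \<gamma> \<rho> * R l \<gamma> \<beta> \<nu>) \<and>
     (\<Sum>\<gamma>\<in>UNIV. bar R l \<alpha> \<gamma> \<nu> * bar R \<mu> \<gamma> \<beta> \<rho>) = (\<Sum>\<gamma>\<in>UNIV. bar R \<mu> \<alpha> \<gamma> \<rho> * bar R l \<gamma> \<beta> \<nu>) \<and>
     (\<Sum>\<gamma>\<in>UNIV. R l \<alpha> \<gamma> \<nu> * bar R \<mu> \<gamma> \<beta> \<rho>) = (\<Sum>\<gamma>\<in>UNIV. bar R \<mu> \<alpha> \<gamma> \<rho> * R l \<gamma> \<beta> \<nu>))"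

definition cond_C4 :: "('a::finite, 'b::finite) rmat \<Rightarrow> bool" where
  "cond_C4 R \<longleftrightarrow>
     (\<forall>\<gamma> \<alpha> \<mu> \<nu>. (\<Sum>l\<in>UNIV. \<Sum>\<beta>\<in>UNIV. R l \<gamma> \<beta> \<nu> * R l \<beta> \<alpha> \<mu>) = kron \<gamma> \<alpha> * kron \<mu> \<nu>) \<and>
     (\<forall>l \<mu> \<beta> \<gamma>. (\<Sum>\<alpha>\<in>UNIV. \<Sum>\<rho>\<in>UNIV. R l \<alpha> \<beta> \<rho> * R \<rho> \<alpha> \<gamma> \<mu>) = kron l \<mu> * kron \<beta> \<gamma>)"


section \<open>The Koszul dual and the Clifford algebra\<close>

text \<open>A relation \<open>u = v\<close> is encoded as the element \<open>u - v\<close> of the free algebra on the generators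
  \<open>'a + 'b\<close>.  The letter \<open>Inl l\<close> stands for $\theta^1_\lambda$, resp. $\Gamma^1_\lambda$, and
  \<open>Inr \<alpha>\<close> for $\theta^2_\alpha$, resp. $\Gamma^2_\alpha$.\<close>

definition koszul_rels :: "('a::finite, 'b::finite) rmat \<Rightarrow> ('a + 'b) free set" where
  "koszul_rels R =
     {gen (Inl l) * gen (Inl \<mu>) - (- (gen (Inl \<mu>) * gen (Inl l))) |l \<mu>. True} \<union>
     {gen (Inr \<alpha>) * gen (Inr \<beta>) - (- (gen (Inr \<beta>) * gen (Inr \<alpha>))) |\<alpha> \<beta>. True} \<union>
     {gen (Inr \<beta>) * gen (Inl \<mu>)
        - (- (\<Sum>l\<in>UNIV. \<Sum>\<alpha>\<in>UNIV. scal (R l \<alpha> \<beta> \<mu>) (gen (Inl l) * gen (Inr \<alpha>)))) |\<beta> \<mu>. True}"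

definition koszul_dual :: "('a::finite, 'b::finite) rmat \<Rightarrow> (complex, ('a + 'b) free set) module" where
  "koszul_dual R = presented_alg (koszul_rels R)"

definition koszul_grading :: "('a::finite, 'b::finite) rmat \<Rightarrow> nat \<Rightarrow> ('a + 'b) free set set" where
  "koszul_grading R = word_grading (koszul_rels R)"

definition clifford_rels :: "('a::finite, 'b::finite) rmat \<Rightarrow> ('a + 'b) free set" where
  "clifford_rels R =
     {gen (Inl l) * gen (Inl \<mu>) + gen (Inl \<mu>) * gen (Inl l) - scal (2 * kron l \<mu>) 1 |l \<mu>. True} \<union>
     {gen (Inr \<alpha>) * gen (Inr \<beta>) + gen (Inr \<beta>) * gen (Inr \<alpha>) - scal (2 * kron \<alpha> \<beta>) 1 |\<alpha> \<beta>. True} \<union>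
     {gen (Inr \<beta>) * gen (Inl \<mu>)
        + (\<Sum>l\<in>UNIV. \<Sum>\<alpha>\<in>UNIV. scal (R l \<alpha> \<beta> \<mu>) (gen (Inl l) * gen (Inr \<alpha>))) |\<beta> \<mu>. True}"

definition clifford :: "('a::finite, 'b::finite) rmat \<Rightarrow> (complex, ('a + 'b) free set) module" where
  "clifford R = presented_alg (clifford_rels R)"

definition clifford_filt :: "('a::finite, 'b::finite) rmat \<Rightarrow> nat \<Rightarrow> ('a + 'b) free set set" where
  "clifford_filt R = word_filtration (clifford_rels R)"

definition gr_clifford ::
  "('a::finite, 'b::finite) rmat \<Rightarrow> (complex, nat \<Rightarrow> ('a + 'b) free set set) module" where
  "gr_clifford R = gr_alg (clifford R) (clifford_filt R)"

definition gr_clifford_grading ::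
  "('a::finite, 'b::finite) rmat \<Rightarrow> nat \<Rightarrow> (nat \<Rightarrow> ('a + 'b) free set set) set" where
  "gr_clifford_grading R = gr_grading (clifford R) (clifford_filt R)"

definition is_can ::
  "('a::finite, 'b::finite) rmat \<Rightarrow> (('a + 'b) free set \<Rightarrow> nat \<Rightarrow> ('a + 'b) free set set) \<Rightarrow> bool" where
  "is_can R f \<longleftrightarrow> alg_hom (koszul_dual R) (gr_clifford R) f \<and>
     (\<forall>g. f (cls (koszul_rels R) (gen g)) =
            gr_incl (clifford R) (clifford_filt R) 1 (cls (clifford_rels R) (gen g)))"

end

theory Submission
  imports Defs
begin


text \<open>
Write \<open>I\<^sub>K\<close> and \<open>I\<^sub>C\<close> for the ideals of relations of the Koszul dual and of the Clifford algebra in the free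
algebra \<open>F\<close> on the letters \<open>'a + 'b\<close>.  The relations of the Koszul dual are the quadratic parts of those of the
Clifford algebra, so \<open>can\<close> exists: it sends the class of \<open>x\<close> to the family of the classes of its homogeneous
components (\<open>symb\<close>).  Surjectivity is clear, and injectivity is a theorem of Poincare-Birkhoff-Witt type: if \<open>x\<close> is
homogeneous of degree \<open>n\<close> and \<open>x - b \<in> I\<^sub>C\<close> with \<open>b\<close> of degree less than \<open>n\<close>, then \<open>x \<in> I\<^sub>K\<close>.

As for the classical Clifford algebra, this is shown by letting the generator \<open>g\<close> of the Clifford algebra act on the
exterior algebra \<open>F / I\<^sub>K\<close> as the sum of the left multiplication by \<open>g\<close> and a contraction.  Applied to the unit, this
gives for every \<open>x\<close> an element of \<open>F / I\<^sub>K\<close> with the same leading part as \<open>x\<close>.  Elements of \<open>I\<^sub>C\<close> act as zero and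
\<open>I\<^sub>K\<close> is homogeneous, so leading parts of elements of \<open>I\<^sub>C\<close> lie in \<open>I\<^sub>K\<close>.

The contractions exist because of the conditions on \<open>R\<close>.  The matrix \<open>R\<close>, used to exchange letters of different type,
and the flip of letters of the same type form one operator \<open>T\<close> on pairs of letters (\<open>braid_of\<close>), for which the
relations read \<open>h g + T(h g) = 0\<close> and \<open>h g + T(h g) = 2 \<delta>\<^bsub>h g\<^esub>\<close>.  The contraction by \<open>h\<close> is the \<open>T\<close>-twisted
skew derivation with \<open>g \<mapsto> \<delta>\<^bsub>h g\<^esub>\<close>.  That it descends to the exterior algebra and that the action satisfies the
Clifford relations follows from four properties of \<open>T\<close>: it is an involution, it satisfies the braid relation, it is
compatible with the pairing of letters in that \<open>T\<close> is invariant under a rotation of its four indices, and its partial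
contraction with the pairing gives the pairing.  The braid relation amounts to C2 and C3.  Involutivity and
rotation invariance come from C4, in which two left inverses of the same matrix are given; they agree because
C1 provides a right inverse.
\<close>

section \<open>The free algebra as a graded vector space\<close>

text \<open>The monomial given by a word.\<close>

abbreviation mon :: "'g list \<Rightarrow> 'g free" where
  "mon w \<equiv> Poly_Mapping.single (Word w) 1"

lemma lookup_scal [simp]: "Poly_Mapping.lookup (scal c x) w = c * Poly_Mapping.lookup x w"
  unfolding scal_def by (transfer) (auto simp: when_def)

lemma scal_conv_mult: "scal c x = Poly_Mapping.single 0 c * x"
  unfolding scal_def by (rule mult_map_scale_conv_mult)

interpretation free: vector_space scal
  by unfold_locales (auto intro!: poly_mapping_eqI simp: lookup_add algebra_simps)

lemma scal_single [simp]: "scal c (Poly_Mapping.single w d) = Poly_Mapping.single w (c * d)"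
  by (auto intro!: poly_mapping_eqI simp: lookup_single when_def)

lemma free_expand: "x = (\<Sum>w\<in>Poly_Mapping.keys x. scal (Poly_Mapping.lookup x w) (Poly_Mapping.single w 1))"
  by (rule poly_mapping_eqI)
     (auto simp: lookup_sum lookup_single when_def in_keys_iff if_distrib sum.delta cong: if_cong)

lemma free_induct [case_names mon add scal]:
  fixes x :: "'g free"
  assumes "\<And>w. P (mon w)" and "\<And>x y. P x \<Longrightarrow> P y \<Longrightarrow> P (x + y)" and "\<And>c x. P x \<Longrightarrow> P (scal c x)"
  shows "P x"
proof -
  have 0: "P 0" using assms(3)[OF assms(1), of 0] by simp
  have "P (Poly_Mapping.single w 1)" for w using assms(1)[of "letters w"] by simp
  then have "P (\<Sum>w\<in>A. scal (c w) (Poly_Mapping.single w 1))" for A and c :: "'g fword \<Rightarrow> complex"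
    using 0 assms(2,3) by (induction A rule: infinite_finite_induct) (auto simp del: scal_single)
  then show ?thesis by (subst free_expand)
qed

lemma mult_scal_left [simp]: "scal c x * y = scal c (x * y)"
  by (simp add: scal_conv_mult mult.assoc)

lemma mult_scal_right [simp]: "x * scal c y = scal c (x * y)"
proof -
  have "x * Poly_Mapping.single 0 c = scal c x"
    by (induction x rule: free_induct)
       (simp_all add: mult_single distrib_right free.scale_right_distrib free.scale_left_commute del: scal_single,
        simp)
  then show ?thesis by (simp add: scal_conv_mult flip: mult.assoc)
qed

lemma mon_Nil [simp]: "mon [] = 1"
  by (simp add: zero_fword_def[symmetric])

lemma mon_mult [simp]: "mon v * mon w = mon (v @ w)"
  by (simp add: mult_single plus_fword_def)

lemma mon_Cons: "mon (g # w) = gen g * mon w"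
  by (simp add: gen_def)

text \<open>The linear extension of a map given on words.\<close>

definition lin :: "('g list \<Rightarrow> 'h free) \<Rightarrow> 'g free \<Rightarrow> 'h free" where
  "lin f x = (\<Sum>w\<in>Poly_Mapping.keys x. scal (Poly_Mapping.lookup x w) (f (letters w)))"

lemma lin_superset:
  assumes "finite A" and "Poly_Mapping.keys x \<subseteq> A"
  shows "lin f x = (\<Sum>w\<in>A. scal (Poly_Mapping.lookup x w) (f (letters w)))"
  unfolding lin_def using assms by (intro sum.mono_neutral_left) (auto simp: in_keys_iff)

lemma lin_add: "lin f (x + y) = lin f x + lin f y"
proof -
  let ?A = "Poly_Mapping.keys x \<union> Poly_Mapping.keys y"
  have "Poly_Mapping.keys (x + y) \<subseteq> ?A" by (rule Poly_Mapping.keys_add)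
  then show ?thesis
    by (simp add: lin_superset[of ?A] lookup_add free.scale_left_distrib sum.distrib)
qed

lemma lin_scal: "lin f (scal c x) = scal c (lin f x)"
proof -
  have "Poly_Mapping.keys (scal c x) \<subseteq> Poly_Mapping.keys x" by (auto simp: in_keys_iff)
  then show ?thesis
    by (simp add: lin_superset[of "Poly_Mapping.keys x"] free.scale_sum_right)
qed

lemma lin_mon [simp]: "lin f (mon w) = f w"
  by (simp add: lin_def)

text \<open>Linear maps between free algebras; they are determined by their values on monomials.\<close>

abbreviation linear_map :: "('g free \<Rightarrow> 'h free) \<Rightarrow> bool" where
  "linear_map f \<equiv> module_hom scal scal f"

lemma linear_mapI:
  assumes "\<And>x y. f (x + y) = f x + f y" and "\<And>c x. f (scal c x) = scal c (f x)"
  shows "linear_map f"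
  using assms by (simp add: module_hom_iff free.module_axioms)

lemma linear_lin: "linear_map (lin f)"
  by (intro linear_mapI lin_add lin_scal)

lemma linear_map_eqI:
  assumes "linear_map f" and "linear_map g" and "\<And>w. f (mon w) = g (mon w)"
  shows "f x = g x"
  by (induction x rule: free_induct)
     (simp_all add: assms module_hom.add[OF assms(1)] module_hom.add[OF assms(2)]
        module_hom.scale[OF assms(1)] module_hom.scale[OF assms(2)])

text \<open>\<open>below n\<close> is the space of elements of degree less than \<open>n\<close>, \<open>homog n\<close> that of the homogeneous elements
  of degree \<open>n\<close>, and \<open>hcomp n x\<close> is the homogeneous component of \<open>x\<close> of degree \<open>n\<close>.  The strict bound makes
  \<open>below 0\<close> the zero space, in agreement with the convention $F^{-1} = 0$.\<close>

definition below :: "nat \<Rightarrow> 'g free set" where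
  "below n = {x. \<forall>w\<in>Poly_Mapping.keys x. wlen w < n}"

definition homog :: "nat \<Rightarrow> 'g free set" where
  "homog n = {x. \<forall>w\<in>Poly_Mapping.keys x. wlen w = n}"

definition hcomp :: "nat \<Rightarrow> 'g free \<Rightarrow> 'g free" where
  "hcomp n = lin (\<lambda>w. if length w = n then mon w else 0)"

lemma hcomp_add: "hcomp n (x + y) = hcomp n x + hcomp n y"
  and hcomp_scal: "hcomp n (scal c x) = scal c (hcomp n x)"
  and linear_hcomp: "linear_map (hcomp n)"
  by (simp_all add: hcomp_def lin_add lin_scal linear_lin)

lemmas hcomp_zero [simp] = module_hom.zero[OF linear_hcomp]
lemmas hcomp_diff = module_hom.diff[OF linear_hcomp]
lemmas hcomp_sum = module_hom.sum[OF linear_hcomp]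

lemma hcomp_mon: "hcomp n (mon w) = (if length w = n then mon w else 0)"
  by (simp add: hcomp_def)

lemma lookup_hcomp: "Poly_Mapping.lookup (hcomp n x) w = (if wlen w = n then Poly_Mapping.lookup x w else 0)"
  by (induction x rule: free_induct)
     (auto simp: hcomp_add hcomp_scal lookup_add hcomp_mon lookup_single when_def wlen_def)

lemma below_zero [simp]: "0 \<in> below n"
  by (simp add: below_def)

lemma below_add: "x \<in> below n \<Longrightarrow> y \<in> below n \<Longrightarrow> x + y \<in> below n"
  using Poly_Mapping.keys_add[of x y] by (fastforce simp: below_def)

lemma below_scal: "x \<in> below n \<Longrightarrow> scal c x \<in> below n"
  by (auto simp: below_def in_keys_iff)

lemma below_minus: "x \<in> below n \<Longrightarrow> - x \<in> below n"
  by (auto simp: below_def in_keys_iff)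

lemma below_diff: "x \<in> below n \<Longrightarrow> y \<in> below n \<Longrightarrow> x - y \<in> below n"
  using below_add[OF _ below_minus] by fastforce

lemma below_sum: "(\<And>i. i \<in> A \<Longrightarrow> f i \<in> below n) \<Longrightarrow> sum f A \<in> below n"
  by (induction A rule: infinite_finite_induct) (auto intro: below_add)

lemma below_mono: "x \<in> below m \<Longrightarrow> m \<le> n \<Longrightarrow> x \<in> below n"
  by (auto simp: below_def)

lemma wlen_plus [simp]: "wlen (v + w) = wlen v + wlen w"
  by (simp add: wlen_def plus_fword_def)

lemma below_mult: "x \<in> below m \<Longrightarrow> y \<in> below (Suc n) \<Longrightarrow> x * y \<in> below (m + n)"
  using Poly_Mapping.keys_mult[of x y] unfolding below_def by force

lemma below_mult': "x \<in> below (Suc m) \<Longrightarrow> y \<in> below n \<Longrightarrow> x * y \<in> below (m + n)"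
  using Poly_Mapping.keys_mult[of x y] unfolding below_def by force

lemma below_0: "below 0 = {0}"
  unfolding below_def by (auto simp flip: Poly_Mapping.keys_eq_empty)

lemma mon_below: "mon w \<in> below n \<longleftrightarrow> length w < n"
  by (simp add: below_def wlen_def)

lemma linear_map_below:
  assumes "linear_map f" and "\<And>w. length w < n \<Longrightarrow> f (mon w) \<in> below m" and "x \<in> below n"
  shows "f x \<in> below m"
proof -
  have "f x = (\<Sum>w\<in>Poly_Mapping.keys x. scal (Poly_Mapping.lookup x w) (f (mon (letters w))))"
    by (subst free_expand[of x])
       (simp add: module_hom.sum[OF assms(1)] module_hom.scale[OF assms(1)] del: scal_single)
  moreover have "f (Poly_Mapping.single w 1) \<in> below m" if "w \<in> Poly_Mapping.keys x" for w
    using assms(2)[of "letters w"] assms(3) that by (auto simp: below_def[of n] wlen_def)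
  ultimately show ?thesis by (auto intro!: below_sum below_scal)
qed

lemma homog_below: "x \<in> homog n \<Longrightarrow> n < m \<Longrightarrow> x \<in> below m"
  by (auto simp: below_def homog_def)

lemma hcomp_homog: "hcomp n x \<in> homog n"
  by (auto simp: homog_def in_keys_iff lookup_hcomp split: if_splits)

lemma hcomp_of_homog: "x \<in> homog n \<Longrightarrow> hcomp m x = (if m = n then x else 0)"
  by (rule poly_mapping_eqI) (auto simp: homog_def in_keys_iff lookup_hcomp)

lemma hcomp_of_below: "x \<in> below n \<Longrightarrow> hcomp n x = 0"
  by (rule poly_mapping_eqI) (auto simp: below_def in_keys_iff lookup_hcomp)

lemma diff_hcomp_below: "x \<in> below (Suc n) \<Longrightarrow> x - hcomp n x \<in> below n"
  by (auto simp: below_def in_keys_iff lookup_hcomp lookup_minus less_Suc_eq Ball_def split: if_splits)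

lemma hcomp_expand:
  assumes "x \<in> below n" shows "x = (\<Sum>i<n. hcomp i x)"
  using assms by (intro poly_mapping_eqI) (auto simp: below_def lookup_sum lookup_hcomp in_keys_iff)

lemma ex_below: "\<exists>n. x \<in> below n"
  unfolding below_def
  by (rule exI[of _ "Suc (Max (wlen ` Poly_Mapping.keys x))"]) (auto simp: less_Suc_eq_le)

lemma hcomp_mult: "hcomp n (x * y) = (\<Sum>i\<le>n. hcomp i x * hcomp (n - i) y)"
proof (induction x rule: free_induct)
  case (mon v)
  show ?case
  proof (induction y rule: free_induct)
    case (mon w)
    have "(\<Sum>i\<le>n. hcomp i (mon v) * hcomp (n - i) (mon w)) =
      (\<Sum>i\<le>n. if i = length v then (if length w = n - length v then mon (v @ w) else 0) else 0)"
      by (intro sum.cong) (auto simp: hcomp_mon)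
    also have "\<dots> = hcomp n (mon (v @ w))"
      by (auto simp: hcomp_mon)
    finally show ?case by simp
  next
    case (add x y)
    then show ?case by (simp add: hcomp_add distrib_left sum.distrib)
  next
    case (scal c x)
    then show ?case by (simp add: hcomp_scal free.scale_sum_right)
  qed
next
  case (add x y)
  then show ?case by (simp add: hcomp_add distrib_right sum.distrib)
next
  case (scal c x)
  then show ?case by (simp add: hcomp_scal free.scale_sum_right)
qed

section \<open>Two-sided ideals of the free algebra and presented algebras\<close>

lemma free_alg_simps [simp]:
  "carrier free_alg = UNIV" "mult free_alg = (*)" "one free_alg = 1" "zero free_alg = 0"
  "add free_alg = (+)" "smult free_alg = scal"
  by (simp_all add: free_alg_def)

lemma ring_free_alg: "ring (free_alg :: (complex, 'g free) module)"
proof (rule ringI)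
  show "abelian_group (free_alg :: (complex, 'g free) module)"
    by (rule abelian_groupI) (auto simp: algebra_simps intro: exI[of _ "- x" for x])
  show "Group.monoid (free_alg :: (complex, 'g free) module)"
    by unfold_locales (auto simp: algebra_simps)
qed (auto simp: algebra_simps)

text \<open>\<open>rel_ideal S\<close> is the two-sided ideal of relations that follow from \<open>S\<close>.\<close>

abbreviation rel_ideal :: "'g free set \<Rightarrow> 'g free set" where
  "rel_ideal S \<equiv> Idl\<^bsub>free_alg\<^esub> S"

lemma ideal_rel_ideal: "ideal (rel_ideal S) free_alg"
  by (rule ring.genideal_ideal[OF ring_free_alg]) simp

lemma rel_ideal_base: "x \<in> S \<Longrightarrow> x \<in> rel_ideal S"
  using ring.genideal_self[OF ring_free_alg, of S] by auto

lemma rel_ideal_zero [simp]: "0 \<in> rel_ideal S"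
  using additive_subgroup.zero_closed[OF ideal.axioms(1)[OF ideal_rel_ideal]] by simp

lemma rel_ideal_add: "x \<in> rel_ideal S \<Longrightarrow> y \<in> rel_ideal S \<Longrightarrow> x + y \<in> rel_ideal S"
  using additive_subgroup.a_closed[OF ideal.axioms(1)[OF ideal_rel_ideal]] by fastforce

lemma rel_ideal_lmult: "x \<in> rel_ideal S \<Longrightarrow> y * x \<in> rel_ideal S"
  using ideal.I_l_closed[OF ideal_rel_ideal] by fastforce

lemma rel_ideal_rmult: "x \<in> rel_ideal S \<Longrightarrow> x * y \<in> rel_ideal S"
  using ideal.I_r_closed[OF ideal_rel_ideal] by fastforce

lemma rel_ideal_scal: "x \<in> rel_ideal S \<Longrightarrow> scal c x \<in> rel_ideal S"
  by (simp add: scal_conv_mult rel_ideal_lmult)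

lemma rel_ideal_minus: "x \<in> rel_ideal S \<Longrightarrow> - x \<in> rel_ideal S"
  using rel_ideal_lmult[of x S "-1"] by simp

lemma rel_ideal_diff: "x \<in> rel_ideal S \<Longrightarrow> y \<in> rel_ideal S \<Longrightarrow> x - y \<in> rel_ideal S"
  using rel_ideal_add[OF _ rel_ideal_minus] by fastforce

lemma rel_ideal_sum: "(\<And>i. i \<in> A \<Longrightarrow> f i \<in> rel_ideal S) \<Longrightarrow> sum f A \<in> rel_ideal S"
  by (induction A rule: infinite_finite_induct) (auto intro: rel_ideal_add)

lemma rel_ideal_subset:
  assumes "S \<subseteq> J" and "0 \<in> J" and "\<And>x y. x \<in> J \<Longrightarrow> y \<in> J \<Longrightarrow> x + y \<in> J"
    and l: "\<And>x y. x \<in> J \<Longrightarrow> y * x \<in> J" and r: "\<And>x y. x \<in> J \<Longrightarrow> x * y \<in> J"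
  shows "rel_ideal S \<subseteq> J"
proof (rule ring.genideal_minimal[OF ring_free_alg _ assms(1)])
  have neg: "\<ominus>\<^bsub>free_alg\<^esub> x = - x" for x :: "'g free"
    by (rule abelian_group.minus_equality[OF ring.is_abelian_group[OF ring_free_alg]]) auto
  show "ideal J free_alg"
    by (rule idealI[OF ring_free_alg])
       (use assms l[of _ "-1"] in \<open>auto simp: neg[unfolded a_inv_def, simplified] intro!: subgroup.intro\<close>)
qed

lemma rel_ideal_mono: "S \<subseteq> T \<Longrightarrow> rel_ideal S \<subseteq> rel_ideal T"
  by (rule ring.subset_Idl_subset[OF ring_free_alg]) auto


section \<open>Involutive braidings and their contractions\<close>

lemma sum_swap2: "(\<Sum>x\<in>A. \<Sum>y\<in>B. \<Sum>z\<in>C. f x y z) = (\<Sum>z\<in>C. \<Sum>x\<in>A. \<Sum>y\<in>B. f x y z)"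
  by (rule trans[OF sum.cong[OF refl sum.swap] sum.swap])

lemma sum_swap3: "(\<Sum>v\<in>D. \<Sum>x\<in>A. \<Sum>y\<in>B. \<Sum>z\<in>C. f v x y z) = (\<Sum>z\<in>C. \<Sum>v\<in>D. \<Sum>x\<in>A. \<Sum>y\<in>B. f v x y z)"
  by (rule trans[OF sum.cong[OF refl sum_swap2] sum.swap])

lemma sum_swap4: "(\<Sum>u\<in>E. \<Sum>v\<in>D. \<Sum>x\<in>A. \<Sum>y\<in>B. \<Sum>z\<in>C. f u v x y z) =
    (\<Sum>z\<in>C. \<Sum>u\<in>E. \<Sum>v\<in>D. \<Sum>x\<in>A. \<Sum>y\<in>B. f u v x y z)"
  by (rule trans[OF sum.cong[OF refl sum_swap3] sum.swap])

lemma scal_kron_sum: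
  fixes c :: "'i::finite \<Rightarrow> 'g free"
  shows "(\<Sum>i\<in>UNIV. scal (kron i j * d i) (c i)) = scal (d j) (c j)"
    and "(\<Sum>i\<in>UNIV. scal (kron j i * d i) (c i)) = scal (d j) (c j)"
  by (auto simp: kron_def if_distrib[of "\<lambda>x. scal (x * _) _"] cong: if_cong)

text \<open>An operator on pairs of letters, \<open>T h g a b\<close> being the coefficient of the word \<open>a b\<close> in the image of
  \<open>h g\<close>.  The letter \<open>h\<close> passes \<open>g\<close> from left to right, so that \<open>a\<close> is thought of as the successor of \<open>g\<close>, and \<open>b\<close>
  as that of \<open>h\<close>.  The form \<open>kron\<close> is a pairing of letters; by \<open>rotate\<close>, the four indices of \<open>T\<close> may be rotated
  when they are moved between the two sides by means of that pairing.\<close>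

locale braiding =
  fixes T :: "'g::finite \<Rightarrow> 'g \<Rightarrow> 'g \<Rightarrow> 'g \<Rightarrow> complex"
  assumes involutive: "(\<Sum>a\<in>UNIV. \<Sum>b\<in>UNIV. T h g a b * T a b c d) = kron h c * kron g d"
    and rotate: "T g k h b = T h g b k"
    and braid: "(\<Sum>p\<in>UNIV. \<Sum>q\<in>UNIV. \<Sum>r\<in>UNIV. T g k p q * T h p a r * T r q b c) =
      (\<Sum>p\<in>UNIV. \<Sum>q\<in>UNIV. \<Sum>r\<in>UNIV. T h g p q * T q k r c * T p r a b)"
    and trace: "(\<Sum>a\<in>UNIV. T h g a a) = kron h g"
begin

text \<open>\<open>br f h g\<close> is the value at the image of \<open>h g\<close> under the braiding of the linear map with \<open>a b \<mapsto> f a b\<close>.\<close>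

definition br :: "('g \<Rightarrow> 'g \<Rightarrow> 'g free) \<Rightarrow> 'g \<Rightarrow> 'g \<Rightarrow> 'g free" where
  "br f h g = (\<Sum>a\<in>UNIV. \<Sum>b\<in>UNIV. scal (T h g a b) (f a b))"

lemma br_add: "br (\<lambda>a b. f a b + f' a b) h g = br f h g + br f' h g"
  by (simp add: br_def free.scale_right_distrib sum.distrib)

lemma br_diff: "br (\<lambda>a b. f a b - f' a b) h g = br f h g - br f' h g"
  by (simp add: br_def free.scale_right_diff_distrib sum_subtractf)

lemma linear_br:
  assumes "linear_map L" shows "L (br f h g) = br (\<lambda>a b. L (f a b)) h g"
  by (simp add: br_def module_hom.sum[OF assms] module_hom.scale[OF assms])

lemma br_scal: "br (\<lambda>a b. scal c (f a b)) h g = scal c (br f h g)"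
  by (rule linear_br[symmetric]) (auto intro!: linear_mapI simp: free.scale_right_distrib mult.commute)

lemma br_mult_left: "x * br f h g = br (\<lambda>a b. x * f a b) h g"
  by (rule linear_br) (auto intro!: linear_mapI simp: distrib_left)

lemma br_mult_right: "br f h g * x = br (\<lambda>a b. f a b * x) h g"
  by (rule linear_br) (auto intro!: linear_mapI simp: distrib_right)

lemma br_ideal: "(\<And>a b. f a b \<in> rel_ideal S) \<Longrightarrow> br f h g \<in> rel_ideal S"
  unfolding br_def by (intro rel_ideal_sum rel_ideal_scal)

lemma br_br: "br (br f) h g = f h g"
proof -
  have "br (br f) h g =
      (\<Sum>a\<in>UNIV. \<Sum>b\<in>UNIV. \<Sum>c\<in>UNIV. \<Sum>d\<in>UNIV. scal (T h g a b * T a b c d) (f c d))"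
    by (simp add: br_def free.scale_sum_right)
  also have "\<dots> = (\<Sum>c\<in>UNIV. \<Sum>a\<in>UNIV. \<Sum>b\<in>UNIV. \<Sum>d\<in>UNIV. scal (T h g a b * T a b c d) (f c d))"
    by (rule sum_swap2)
  also have "\<dots> = (\<Sum>c\<in>UNIV. \<Sum>d\<in>UNIV. \<Sum>a\<in>UNIV. \<Sum>b\<in>UNIV. scal (T h g a b * T a b c d) (f c d))"
    by (rule sum.cong[OF refl], rule sum_swap2)
  also have "\<dots> = (\<Sum>c\<in>UNIV. \<Sum>d\<in>UNIV. scal (kron h c * kron g d) (f c d))"
    by (simp add: free.scale_sum_left flip: involutive)
  also have "\<dots> = (\<Sum>c\<in>UNIV. scal (kron h c) (f c g))"
    by (simp flip: free.scale_scale free.scale_sum_right add: scal_kron_sum(2)[where d = "\<lambda>_. 1", simplified])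
  also have "\<dots> = f h g"
    by (simp add: scal_kron_sum(2)[where d = "\<lambda>_. 1", simplified])
  finally show ?thesis .
qed

lemma br_kron_diag: "br (\<lambda>a b. scal (kron a b) y) h g = scal (kron h g) y"
proof -
  have "br (\<lambda>a b. scal (kron a b) y) h g = (\<Sum>a\<in>UNIV. scal (T h g a a) y)"
    by (simp add: br_def mult.commute[of _ "kron _ _"] scal_kron_sum)
  then show ?thesis by (simp add: trace flip: free.scale_sum_left)
qed

lemma br_kron_left: "br (\<lambda>a b. scal (kron h a) (f b)) g k = (\<Sum>b\<in>UNIV. scal (T g k h b) (f b))"
  unfolding br_def by (subst sum.swap) (simp add: mult.commute[of _ "kron _ _"] scal_kron_sum)

lemma br_kron_right: "br (\<lambda>a b. scal (kron b k) (f a)) h g = (\<Sum>a\<in>UNIV. scal (T h g a k) (f a))"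
  by (simp add: br_def mult.commute[of _ "kron _ _"] scal_kron_sum)

text \<open>On the left, the letters \<open>g k\<close> are braided before \<open>h\<close> passes both of them; on the right, afterwards.\<close>

lemma br_braid:
  "br (\<lambda>p q. br (\<lambda>a r. br (f a) r q) h p) g k = br (\<lambda>p q. br (\<lambda>r c. br (\<lambda>a b. f a b c) p r) q k) h g"
proof -
  have "br (\<lambda>p q. br (\<lambda>a r. br (f a) r q) h p) g k = 
      (\<Sum>p\<in>UNIV. \<Sum>q\<in>UNIV. \<Sum>a\<in>UNIV. \<Sum>r\<in>UNIV. \<Sum>b\<in>UNIV. \<Sum>c\<in>UNIV.
        scal (T g k p q * T h p a r * T r q b c) (f a b c))"
    by (simp add: br_def free.scale_sum_right mult.assoc)
  also have "\<dots> = (\<Sum>a\<in>UNIV. \<Sum>p\<in>UNIV. \<Sum>q\<in>UNIV. \<Sum>r\<in>UNIV. \<Sum>b\<in>UNIV. \<Sum>c\<in>UNIV.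
        scal (T g k p q * T h p a r * T r q b c) (f a b c))"
    by (rule sum_swap2)
  also have "\<dots> = (\<Sum>a\<in>UNIV. \<Sum>b\<in>UNIV. \<Sum>p\<in>UNIV. \<Sum>q\<in>UNIV. \<Sum>r\<in>UNIV. \<Sum>c\<in>UNIV.
        scal (T g k p q * T h p a r * T r q b c) (f a b c))"
    by (rule sum.cong[OF refl], rule sum_swap3)
  also have "\<dots> = (\<Sum>a\<in>UNIV. \<Sum>b\<in>UNIV. \<Sum>c\<in>UNIV. \<Sum>p\<in>UNIV. \<Sum>q\<in>UNIV. \<Sum>r\<in>UNIV.
        scal (T g k p q * T h p a r * T r q b c) (f a b c))"
    by (rule sum.cong[OF refl], rule sum.cong[OF refl], rule sum_swap3)
  also have "\<dots> = (\<Sum>a\<in>UNIV. \<Sum>b\<in>UNIV. \<Sum>c\<in>UNIV. \<Sum>p\<in>UNIV. \<Sum>q\<in>UNIV. \<Sum>r\<in>UNIV.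
        scal (T h g p q * T q k r c * T p r a b) (f a b c))"
    by (simp only: free.scale_sum_left[symmetric] braid)
  also have "\<dots> = (\<Sum>a\<in>UNIV. \<Sum>b\<in>UNIV. \<Sum>p\<in>UNIV. \<Sum>q\<in>UNIV. \<Sum>r\<in>UNIV. \<Sum>c\<in>UNIV.
        scal (T h g p q * T q k r c * T p r a b) (f a b c))"
    by (rule sum.cong[OF refl], rule sum.cong[OF refl], rule sum_swap3[symmetric])
  also have "\<dots> = (\<Sum>a\<in>UNIV. \<Sum>p\<in>UNIV. \<Sum>q\<in>UNIV. \<Sum>r\<in>UNIV. \<Sum>c\<in>UNIV. \<Sum>b\<in>UNIV.
        scal (T h g p q * T q k r c * T p r a b) (f a b c))"
    by (rule sum.cong[OF refl], rule sum_swap4[symmetric])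
  also have "\<dots> = (\<Sum>p\<in>UNIV. \<Sum>q\<in>UNIV. \<Sum>r\<in>UNIV. \<Sum>c\<in>UNIV. \<Sum>a\<in>UNIV. \<Sum>b\<in>UNIV.
        scal (T h g p q * T q k r c * T p r a b) (f a b c))"
    by (rule sum_swap4[symmetric])
  also have "\<dots> = br (\<lambda>p q. br (\<lambda>r c. br (\<lambda>a b. f a b c) p r) q k) h g"
    by (simp add: br_def free.scale_sum_right mult.assoc)
  finally show ?thesis .
qed

text \<open>By \<open>rotate\<close>, the coefficients \<open>T h p a q\<close> are those of the braiding from \<open>p q\<close> to \<open>h a\<close>, so involutivity
  applies to their contraction with \<open>T g k p q\<close>.\<close>

lemma br_rotate:
  "br (\<lambda>p q. \<Sum>a\<in>UNIV. scal (T h p a q) (f a)) g k = scal (kron g h) (f k)"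
proof -
  have "br (\<lambda>p q. \<Sum>a\<in>UNIV. scal (T h p a q) (f a)) g k =
      (\<Sum>p\<in>UNIV. \<Sum>q\<in>UNIV. \<Sum>a\<in>UNIV. scal (T g k p q * T p q h a) (f a))"
    unfolding br_def by (simp add: free.scale_sum_right rotate[of _ _ h])
  also have "\<dots> = (\<Sum>a\<in>UNIV. scal (\<Sum>p\<in>UNIV. \<Sum>q\<in>UNIV. T g k p q * T p q h a) (f a))"
    by (subst sum_swap2) (simp add: free.scale_sum_left)
  also have "\<dots> = scal (kron g h) (f k)"
    by (simp add: involutive mult.commute[of _ "kron k _"] scal_kron_sum)
  finally show ?thesis .
qed

lemma br_rotate':
  "br (\<lambda>a b. \<Sum>q\<in>UNIV. scal (T b k a q) (f q)) h g = scal (kron g k) (f h)"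
proof -
  have "br (\<lambda>a b. \<Sum>q\<in>UNIV. scal (T b k a q) (f q)) h g =
      (\<Sum>a\<in>UNIV. \<Sum>b\<in>UNIV. \<Sum>q\<in>UNIV. scal (T h g a b * T a b q k) (f q))"
    unfolding br_def by (simp add: free.scale_sum_right rotate[of _ k])
  also have "\<dots> = (\<Sum>q\<in>UNIV. scal (\<Sum>a\<in>UNIV. \<Sum>b\<in>UNIV. T h g a b * T a b q k) (f q))"
    by (subst sum_swap2) (simp add: free.scale_sum_left)
  also have "\<dots> = scal (kron g k) (f h)"
    by (simp add: involutive scal_kron_sum)
  finally show ?thesis .
qed

text \<open>The relations of the braided exterior algebra; those of the braided Clifford algebra (\<open>cliff_rel\<close>) add the
  pairing as a constant term.\<close>

definition ext_rel :: "'g \<Rightarrow> 'g \<Rightarrow> 'g free" where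
  "ext_rel h g = gen h * gen g + br (\<lambda>a b. gen a * gen b) h g"

abbreviation ext_ideal :: "'g free set" where
  "ext_ideal \<equiv> rel_ideal (range (\<lambda>(h, g). ext_rel h g))"

lemma ext_rel_ideal: "ext_rel h g \<in> ext_ideal"
  by (rule rel_ideal_base) auto

lemma br_ext_rel: "br ext_rel h g = ext_rel h g"
  unfolding ext_rel_def by (simp add: br_add br_br)

lemma ext_rel_homog: "ext_rel h g \<in> homog 2"
proof -
  have "gen a * gen b = mon [a, b]" for a b :: 'g
    by (simp add: gen_def)
  then have "hcomp 2 (ext_rel h g) = ext_rel h g"
    by (simp add: ext_rel_def hcomp_add linear_br[OF linear_hcomp] hcomp_mon)
  then show ?thesis by (metis hcomp_homog)
qed

definition cliff_rel :: "'g \<Rightarrow> 'g \<Rightarrow> 'g free" where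
  "cliff_rel h g = ext_rel h g - scal (2 * kron h g) 1"

text \<open>The contraction by \<open>h\<close>, first on words: a skew derivation that pairs \<open>h\<close> with the first letter, or else lets
  \<open>h\<close> pass it with the sign and the coefficients of the exterior algebra.\<close>

primrec contract_word :: "'g list \<Rightarrow> 'g \<Rightarrow> 'g free" where
  "contract_word [] h = 0"
| "contract_word (k # w) h = scal (kron h k) (mon w) - br (\<lambda>a b. gen a * contract_word w b) h k"

definition contract :: "'g \<Rightarrow> 'g free \<Rightarrow> 'g free" where
  "contract h = lin (\<lambda>w. contract_word w h)"

lemma linear_contract: "linear_map (contract h)"
  unfolding contract_def by (rule linear_lin)

lemma contract_simps [simp]:
  "contract h (x + y) = contract h x + contract h y" "contract h (scal c x) = scal c (contract h x)"
  "contract h 0 = 0"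
  "contract h (x - y) = contract h x - contract h y"
  "contract h (br f g k) = br (\<lambda>a b. contract h (f a b)) g k"
  by (simp_all add: linear_br[OF linear_contract] module_hom.add[OF linear_contract] module_hom.scale[OF linear_contract]
     module_hom.zero[OF linear_contract] module_hom.diff[OF linear_contract])

lemma contract_one [simp]: "contract h 1 = 0"
  by (simp add: contract_def flip: mon_Nil)

text \<open>The recursion for words extends to the product of a letter with an arbitrary element.\<close>

lemma contract_gen: "contract h (gen k * y) = scal (kron h k) y - br (\<lambda>a b. gen a * contract b y) h k"
proof (rule linear_map_eqI[where x = y])
  show "linear_map (\<lambda>y. contract h (gen k * y))"
    by (rule linear_mapI) (simp_all add: distrib_left)
  show "linear_map (\<lambda>y. scal (kron h k) y - br (\<lambda>a b. gen a * contract b y) h k)"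
    by (rule linear_mapI)
      (simp_all add: distrib_left br_add br_scal free.scale_right_distrib free.scale_right_diff_distrib free.scale_left_commute)
  show "contract h (gen k * mon w) = scal (kron h k) (mon w) - br (\<lambda>a b. gen a * contract b (mon w)) h k" for w
    by (simp add: contract_def flip: mon_Cons)
qed

text \<open>The recursion only describes the contraction of a product whose left factor is a letter.  For this reason
  arbitrary right multiples by \<open>y\<close> are built into the statement that relations are mapped into the ideal.  The
  multiples \<open>gen a * y\<close> cancel by \<open>br_rotate\<close> and \<open>rotate\<close>, and the braid relation turns the remaining terms into
  multiples of relations.\<close>

lemma contract_ext_rel: "contract h (ext_rel g k * y) \<in> ext_ideal"
proof -
  define F where "F = (\<lambda>a b c. gen a * gen b * contract c y)"
  have c2: "contract h (gen g * (gen k * y)) = scal (kron h g) (gen k * y)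
      - (\<Sum>a\<in>UNIV. scal (T h g a k) (gen a * y)) + br (\<lambda>a r. br (F a) r k) h g" for h g k
    by (simp add: contract_gen right_diff_distrib br_diff br_mult_left F_def br_kron_right mult.assoc)
  have "contract h (ext_rel g k * y) =
      contract h (gen g * (gen k * y)) + br (\<lambda>p q. contract h (gen p * (gen q * y))) g k"
    by (simp add: ext_rel_def distrib_right br_mult_right mult.assoc)
  also have "\<dots> = br (\<lambda>a r. br (F a) r k) h g + br (\<lambda>p q. br (\<lambda>a r. br (F a) r q) h p) g k"
    by (simp add: c2 br_add br_diff br_kron_left br_rotate)
       (simp add: rotate[of g k h] kron_def)
  also have "\<dots> = br (\<lambda>p q. br (\<lambda>r c. ext_rel p r * contract c y) q k) h g"
    by (simp add: br_braid ext_rel_def distrib_right br_add br_mult_right F_def)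
  also have "\<dots> \<in> ext_ideal"
    by (intro br_ideal rel_ideal_rmult ext_rel_ideal)
  finally show ?thesis .
qed

lemma contract_ideal:
  assumes "x \<in> ext_ideal" shows "contract h x \<in> ext_ideal"
proof -
  let ?J = "{x. x \<in> ext_ideal \<and> (\<forall>y h. contract h (x * y) \<in> ext_ideal)}"
  have "ext_ideal \<subseteq> ?J"
  proof (rule rel_ideal_subset)
    fix x y assume x: "x \<in> ?J"
    then show "x * y \<in> ?J"
      by (auto simp: mult.assoc intro: rel_ideal_rmult)
    from x have I: "x \<in> ext_ideal" by blast
    have "contract h (y * x * z) \<in> ext_ideal" for h z
    proof (induction y arbitrary: h rule: free_induct)
      case (mon w)
      show ?case
      proof (induction w arbitrary: h)
        case Nil
        then show ?case using x by simp
      next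
        case (Cons g w)
        then show ?case unfolding mon_Cons mult.assoc contract_gen
          by (intro rel_ideal_diff rel_ideal_scal br_ideal rel_ideal_lmult[OF rel_ideal_rmult[OF I]]
              rel_ideal_lmult[OF Cons[unfolded mult.assoc]])
      qed
    qed (auto simp: distrib_right intro: rel_ideal_add rel_ideal_scal)
    then show "y * x \<in> ?J"
      using rel_ideal_lmult[OF I] by blast
  qed (auto simp: distrib_right contract_ext_rel ext_rel_ideal intro: rel_ideal_add)
  then show ?thesis
    using assms by (metis (no_types, lifting) mem_Collect_eq mult.right_neutral subsetD)
qed

text \<open>The contractions satisfy the relations of the exterior algebra even as operators on the free algebra.\<close>

lemma contract_contract: "contract h (contract g y) + br (\<lambda>a b. contract a (contract b y)) h g = 0"
proof -
  have "contract h (contract g (mon w)) + br (\<lambda>a b. contract a (contract b (mon w))) h g = 0" for w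
  proof (induction w arbitrary: h g)
    case Nil
    then show ?case by (simp add: br_def)
  next
    case (Cons k w)
    define G where "G = (\<lambda>a r q. gen a * contract r (contract q (mon w)))"
    have G0: "G a r q + br (G a) r q = 0" for a r q
      using Cons[of r q] by (simp add: G_def flip: br_mult_left distrib_left)
    have c2: "contract h (contract g (mon (k # w))) = scal (kron g k) (contract h (mon w))
        - (\<Sum>q\<in>UNIV. scal (T g k h q) (contract q (mon w))) + br (\<lambda>p q. br (\<lambda>a r. G a r q) h p) g k" for h g
      unfolding mon_Cons by (simp add: contract_gen br_diff G_def br_kron_left del: scal_single)
    have "contract h (contract g (mon (k # w))) + br (\<lambda>a b. contract a (contract b (mon (k # w)))) h g =
       br (\<lambda>p q. br (\<lambda>a r. G a r q) h p) g k + br (\<lambda>p q. br (\<lambda>r c. br (\<lambda>a b. G a b c) p r) q k) h g"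
      by (simp add: c2 br_add br_diff br_kron_right br_rotate')
         (simp add: rotate[of g k h])
    also have "\<dots> = br (\<lambda>p q. br (\<lambda>a r. G a r q + br (G a) r q) h p) g k"
      by (simp add: br_add flip: br_braid)
    also have "\<dots> = 0"
      by (simp add: G0) (simp add: br_def)
    finally show ?case .
  qed
  note on_words = this
  show ?thesis
  proof (rule linear_map_eqI[where x = y and g = "\<lambda>y. 0"])
    show "linear_map (\<lambda>y. contract h (contract g y) + br (\<lambda>a b. contract a (contract b y)) h g)"
      by (rule linear_mapI) (simp_all add: br_add br_scal free.scale_right_distrib)
    show "linear_map (\<lambda>y :: 'g free. 0 :: 'g free)"
      by (rule linear_mapI) simp_all
  qed (rule on_words)
qed

section \<open>The Clifford action on the exterior algebra\<close>

text \<open>The operator by which the generator \<open>g\<close> of the Clifford algebra acts.  It is defined on the free algebra and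
  descends to the exterior algebra by \<open>cliff_op_ideal\<close>.\<close>

definition cliff_op :: "'g \<Rightarrow> 'g free \<Rightarrow> 'g free" where
  "cliff_op g y = gen g * y + contract g y"

lemma cliff_op_ideal: "y \<in> ext_ideal \<Longrightarrow> cliff_op g y \<in> ext_ideal"
  unfolding cliff_op_def by (intro rel_ideal_add rel_ideal_lmult contract_ideal)

lemma linear_cliff_op: "linear_map (cliff_op g)"
  by (rule linear_mapI) (simp_all add: cliff_op_def distrib_left free.scale_right_distrib)

text \<open>On the free algebra, the relations of the Clifford algebra hold up to relations of the exterior algebra.\<close>

lemma cliff_op_rel:
  "cliff_op h (cliff_op g y) + br (\<lambda>a b. cliff_op a (cliff_op b y)) h g - scal (2 * kron h g) y = ext_rel h g * y"
proof -
  \<comment> \<open>The mixed terms \<open>u - br u\<close> and their braiding \<open>br u - u\<close> cancel by involutivity.\<close>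
  define u where "u = (\<lambda>a b. gen a * contract b y)"
  define v where "v = (\<lambda>a b. contract a (contract b y))"
  have op2: "cliff_op h (cliff_op g y) = gen h * gen g * y + u h g + scal (kron h g) y - br u h g + v h g" for h g
    by (simp add: cliff_op_def distrib_left contract_gen u_def v_def mult.assoc)
  have "br (\<lambda>a b. cliff_op a (cliff_op b y)) h g =
      br (\<lambda>a b. gen a * gen b) h g * y + br u h g + scal (kron h g) y - u h g + br v h g"
    by (simp only: op2 br_add br_diff br_br br_kron_diag br_mult_right)
  moreover have "v h g + br v h g = 0"
    unfolding v_def by (rule contract_contract)
  moreover have "scal (2 * kron h g) y = scal (kron h g) y + scal (kron h g) y"
    by (simp only: mult_2 free.scale_left_distrib)
  ultimately show ?thesis
    by (simp add: op2 ext_rel_def distrib_right add_eq_0_iff)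
qed

text \<open>The action of the free algebra on itself by the operators \<open>cliff_op\<close>.\<close>

definition act :: "'g free \<Rightarrow> 'g free \<Rightarrow> 'g free" where
  "act x y = lin (\<lambda>w. foldr cliff_op w y) x"

lemma act_simps [simp]:
  "act (x + x') y = act x y + act x' y" "act (scal c x) y = scal c (act x y)"
  "act (mon w) y = foldr cliff_op w y"
  by (simp_all add: act_def lin_add lin_scal)

lemma act_one [simp]: "act 1 y = y"
  using act_simps(3)[of "[]"] by simp

lemma linear_act_left: "linear_map (\<lambda>x. act x y)"
  by (rule linear_mapI) simp_all

lemma linear_foldr_cliff_op: "linear_map (foldr cliff_op w)"
  by (induction w)
     (auto intro!: linear_mapI simp: module_hom.add[OF linear_cliff_op] module_hom.scale[OF linear_cliff_op]
        module_hom.add module_hom.scale)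

lemmas foldr_cliff_op_simps = module_hom.add[OF linear_foldr_cliff_op] module_hom.scale[OF linear_foldr_cliff_op]

lemma act_mult: "act (x * x') y = act x (act x' y)"
proof (induction x rule: free_induct)
  case (mon w)
  show ?case
    by (rule linear_map_eqI[where x = x'])
       (auto intro!: linear_mapI simp: distrib_left foldr_cliff_op_simps)
qed (simp_all add: distrib_right)

lemma act_ideal: "y \<in> ext_ideal \<Longrightarrow> act x y \<in> ext_ideal"
proof (induction x rule: free_induct)
  case (mon w)
  then show ?case by (induction w) (auto intro: cliff_op_ideal)
qed (auto intro: rel_ideal_add rel_ideal_scal)

lemma act_gen: "act (gen g) y = cliff_op g y"
  by (simp add: gen_def)

lemma act_cliff_rel: "act (cliff_rel h g) y = ext_rel h g * y"
proof -
  have "act (cliff_rel h g) y =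
      cliff_op h (cliff_op g y) + br (\<lambda>a b. cliff_op a (cliff_op b y)) h g - scal (2 * kron h g) y"
    by (simp add: cliff_rel_def ext_rel_def module_hom.diff[OF linear_act_left] linear_br[OF linear_act_left]
        act_mult act_gen)
  then show ?thesis by (simp only: cliff_op_rel)
qed

lemma act_cliff_ideal:
  assumes "x \<in> rel_ideal (range (\<lambda>(h, g). cliff_rel h g))"
  shows "act x y \<in> ext_ideal"
proof -
  have "rel_ideal (range (\<lambda>(h, g). cliff_rel h g)) \<subseteq> {x. \<forall>y. act x y \<in> ext_ideal}"
    by (rule rel_ideal_subset)
       (auto simp: act_cliff_rel act_mult module_hom.zero[OF linear_act_left]
         intro: act_ideal rel_ideal_add rel_ideal_rmult[OF ext_rel_ideal])
  then show ?thesis using assms by blast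
qed

lemma contract_word_below: "contract_word w h \<in> below (length w)"
proof (induction w arbitrary: h)
  case (Cons k w)
  have "gen a * contract_word w b \<in> below (Suc (length w))" for a b
    using below_mult'[OF _ Cons[of b], of "gen a" 1] by (simp add: below_def gen_def wlen_def)
  then show ?case
    by (auto simp: br_def mon_below simp del: scal_single intro!: below_diff below_scal below_sum)
qed simp

lemma contract_below: "x \<in> below n \<Longrightarrow> contract h x \<in> below n"
  by (rule linear_map_below[OF linear_contract])
     (auto simp: contract_def intro: below_mono[OF contract_word_below])

text \<open>The contractions lower the degree, so only left multiplication contributes to the leading part of \<open>act x 1\<close>.\<close>

lemma act_one_leading:
  assumes "x \<in> below (Suc n)" shows "act x 1 - x \<in> below n"
proof (rule linear_map_below[OF _ _ assms])
  show "linear_map (\<lambda>x. act x 1 - x)"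
    by (rule linear_mapI) (simp_all add: free.scale_right_diff_distrib)
  fix w :: "'g list" assume "length w < Suc n"
  moreover have "foldr cliff_op w 1 - mon w \<in> below (length w)"
  proof (induction w)
    case (Cons g w)
    define z where "z = foldr cliff_op w 1 - mon w"
    have "foldr cliff_op (g # w) 1 - mon (g # w) = gen g * z + contract g z + contract g (mon w)"
      unfolding mon_Cons by (simp add: z_def cliff_op_def right_diff_distrib)
    moreover have "gen g * z \<in> below (length (g # w))"
      using below_mult'[of "gen g" 1 z "length w"] Cons by (simp add: below_def gen_def wlen_def z_def)
    moreover have "contract g z \<in> below (length (g # w))"
      by (rule below_mono[OF contract_below[of _ "length w"]]) (use Cons in \<open>simp_all add: z_def\<close>)
    moreover have "contract g (mon w) \<in> below (length (g # w))"
      by (rule contract_below) (simp add: mon_below)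
    ultimately show ?case by (auto intro: below_add)
  qed simp
  ultimately show "act (mon w) 1 - mon w \<in> below n"
    by (auto intro: below_mono)
qed

text \<open>The braided analogue of the Poincare-Birkhoff-Witt theorem: modulo lower degree, the relations of the
  Clifford algebra have no consequences besides those of the exterior algebra.\<close>

lemma leading_part_cliff_ideal:
  assumes "x - b \<in> rel_ideal (range (\<lambda>(h, g). cliff_rel h g))" and x: "x \<in> homog n" and b: "b \<in> below n"
    and hcomp_ideal: "\<And>y. y \<in> ext_ideal \<Longrightarrow> hcomp n y \<in> ext_ideal"
  shows "x \<in> ext_ideal"
proof -
  have "x - b \<in> below (Suc n)"
    using x b by (auto intro!: below_diff intro: homog_below below_mono)
  then have "hcomp n (act (x - b) 1 - (x - b)) = 0"
    by (intro hcomp_of_below act_one_leading)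
  then have "hcomp n (act (x - b) 1) = x"
    using x b by (simp add: hcomp_diff hcomp_of_homog hcomp_of_below)
  then show ?thesis
    using hcomp_ideal[OF act_cliff_ideal[OF assms(1)]] by metis
qed

end


section \<open>The associated graded algebra of a presented algebra\<close>

lemma hcomp_rel_ideal:
  assumes "\<And>x. x \<in> S \<Longrightarrow> \<exists>m. x \<in> homog m" and "x \<in> rel_ideal S"
  shows "hcomp n x \<in> rel_ideal S"
proof -
  have "rel_ideal S \<subseteq> {x. \<forall>n. hcomp n x \<in> rel_ideal S}"
  proof (rule rel_ideal_subset)
    show "S \<subseteq> {x. \<forall>n. hcomp n x \<in> rel_ideal S}"
      using assms(1) by (fastforce simp: hcomp_of_homog intro: rel_ideal_base)
  qed (auto simp: hcomp_add hcomp_mult intro: rel_ideal_add rel_ideal_sum rel_ideal_lmult rel_ideal_rmult)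
  then show ?thesis using assms(2) by blast
qed

lemma mem_cls: "y \<in> cls S x \<longleftrightarrow> y - x \<in> rel_ideal S"
  by (force simp: cls_def a_r_coset_def r_coset_def)

lemma cls_eq_iff: "cls S x = cls S y \<longleftrightarrow> x - y \<in> rel_ideal S"
proof
  assume "cls S x = cls S y"
  then have "x \<in> cls S y" by (auto simp: mem_cls)
  then show "x - y \<in> rel_ideal S" by (simp add: mem_cls)
next
  assume *: "x - y \<in> rel_ideal S"
  have "z - x \<in> rel_ideal S \<longleftrightarrow> z - y \<in> rel_ideal S" for z
    using rel_ideal_add[of "z - x", OF _ *] rel_ideal_diff[of "z - y", OF _ *] by (auto simp: algebra_simps)
  then show "cls S x = cls S y" by (auto simp: mem_cls)
qed

lemma presented_alg_simps:
  "carrier (presented_alg S) = range (cls S)"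
  "cls S x \<otimes>\<^bsub>presented_alg S\<^esub> cls S y = cls S (x * y)"
  "cls S x \<oplus>\<^bsub>presented_alg S\<^esub> cls S y = cls S (x + y)"
  "\<one>\<^bsub>presented_alg S\<^esub> = cls S 1"
  "\<zero>\<^bsub>presented_alg S\<^esub> = cls S 0"
  "c \<odot>\<^bsub>presented_alg S\<^esub> cls S x = cls S (scal c x)"
proof -
  note defs = presented_alg_def quot_alg_def ring.defs module.defs FactRing_def
  show "carrier (presented_alg S) = range (cls S)"
    by (auto simp: defs A_RCOSETS_def RCOSETS_def cls_def a_r_coset_def)
  show "cls S x \<otimes>\<^bsub>presented_alg S\<^esub> cls S y = cls S (x * y)"
    using ideal.rcoset_mult_add[OF ideal_rel_ideal, of x y S] by (simp add: defs cls_def)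
  show "cls S x \<oplus>\<^bsub>presented_alg S\<^esub> cls S y = cls S (x + y)"
    using ideal.a_rcos_sum[OF ideal_rel_ideal, of x y S] by (simp add: defs cls_def)
  show "\<one>\<^bsub>presented_alg S\<^esub> = cls S 1"
    by (simp add: defs cls_def)
  show "\<zero>\<^bsub>presented_alg S\<^esub> = cls S 0"
    using mem_cls[of _ S 0] by (auto simp: defs)
  have "cls S (scal c y) = cls S (scal c x)" if "y \<in> cls S x" for y
    using rel_ideal_scal[of "y - x" S c] that by (simp add: mem_cls cls_eq_iff free.scale_right_diff_distrib)
  moreover have "x \<in> cls S x" by (simp add: mem_cls)
  ultimately have "(\<Union>y\<in>cls S x. cls S (scal c y)) = cls S (scal c x)"
    by blast
  then show "c \<odot>\<^bsub>presented_alg S\<^esub> cls S x = cls S (scal c x)"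
    by (simp add: defs cls_def)
qed

text \<open>\<open>lower S n\<close> is the space of elements of the free algebra whose class lies in the filtration step $F^{n-1}$.\<close>

definition lower :: "'g free set \<Rightarrow> nat \<Rightarrow> 'g free set" where
  "lower S n = {x. \<exists>b\<in>below n. x - b \<in> rel_ideal S}"

lemma lowerI: "x - b \<in> rel_ideal S \<Longrightarrow> b \<in> below n \<Longrightarrow> x \<in> lower S n"
  by (auto simp: lower_def)

lemma below_lower: "x \<in> below n \<Longrightarrow> x \<in> lower S n"
  by (auto intro: lowerI[of _ x])

lemma lower_add: 
  assumes "x \<in> lower S n" and "y \<in> lower S n" shows "x + y \<in> lower S n"
proof -
  obtain b c where "b \<in> below n" "x - b \<in> rel_ideal S" "c \<in> below n" "y - c \<in> rel_ideal S"
    using assms by (auto simp: lower_def)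
  then show ?thesis
    using rel_ideal_add[of "x - b" S "y - c"] by (intro lowerI[of _ "b + c"] below_add) (auto simp: algebra_simps)
qed

lemma lower_scal: "x \<in> lower S n \<Longrightarrow> scal c x \<in> lower S n"
  unfolding lower_def
  using below_scal rel_ideal_scal[of _ S c] by (fastforce simp: free.scale_right_diff_distrib)

lemma lower_mono: "x \<in> lower S m \<Longrightarrow> m \<le> n \<Longrightarrow> x \<in> lower S n"
  unfolding lower_def using below_mono by blast

lemma lower_minus: "x \<in> lower S n \<Longrightarrow> - x \<in> lower S n"
  using lower_scal[of x S n "-1"] by simp

lemma lower_diff: "x \<in> lower S n \<Longrightarrow> y \<in> lower S n \<Longrightarrow> x - y \<in> lower S n"
  using lower_add[OF _ lower_minus] by fastforce

lemma lower_mult: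
  assumes "x \<in> lower S m" and "y \<in> lower S (Suc n)" shows "x * y \<in> lower S (m + n)"
proof -
  obtain b c where b: "b \<in> below m" "x - b \<in> rel_ideal S" and c: "c \<in> below (Suc n)" "y - c \<in> rel_ideal S"
    using assms by (auto simp: lower_def)
  have "(x - b) * y + b * (y - c) \<in> rel_ideal S"
    using b c by (intro rel_ideal_add rel_ideal_lmult rel_ideal_rmult)
  then show ?thesis
    using below_mult[OF b(1) c(1)] by (intro lowerI[of _ "b * c"]) (auto simp: algebra_simps)
qed

lemma lower_mult':
  assumes "x \<in> lower S (Suc m)" and "y \<in> lower S n" shows "x * y \<in> lower S (m + n)"
proof -
  obtain b c where b: "b \<in> below (Suc m)" "x - b \<in> rel_ideal S" and c: "c \<in> below n" "y - c \<in> rel_ideal S"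
    using assms by (auto simp: lower_def)
  have "(x - b) * y + b * (y - c) \<in> rel_ideal S"
    using b c by (intro rel_ideal_add rel_ideal_lmult rel_ideal_rmult)
  then show ?thesis
    using below_mult'[OF b(1) c(1)] by (intro lowerI[of _ "b * c"]) (auto simp: algebra_simps)
qed

lemma word_filtration_eq: "word_filtration S n = cls S ` below (Suc n)"
  by (simp add: word_filtration_def below_def less_Suc_eq_le)

lemma word_grading_eq: "word_grading S n = cls S ` homog n"
  by (simp add: word_grading_def homog_def)

lemma filt_pred_eq: "filt_pred (presented_alg S) (word_filtration S) n = cls S ` below n"
  by (cases n) (simp_all add: filt_pred_def below_0 presented_alg_simps word_filtration_eq)

text \<open>\<open>gr_cls S n x\<close> is the class of \<open>x\<close> in degree \<open>n\<close> of the associated graded algebra, for \<open>x\<close> of degree at most \<open>n\<close>.  It is a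
  set of classes of the presented algebra, namely a coset of $F^{n-1}$.\<close>

definition gr_cls :: "'g free set \<Rightarrow> nat \<Rightarrow> 'g free \<Rightarrow> 'g free set set" where
  "gr_cls S n x = filt_pred (presented_alg S) (word_filtration S) n +>\<^bsub>presented_alg S\<^esub> cls S x"

lemma gr_cls_image: "gr_cls S n x = (\<lambda>b. cls S (b + x)) ` below n"
  by (auto simp: gr_cls_def filt_pred_eq a_r_coset_def r_coset_def presented_alg_simps)

lemma gr_cls_eq: "gr_cls S n x = cls S ` {z. z - x \<in> lower S n}"
proof -
  have "gr_cls S n x = (\<lambda>b. cls S (b + x)) ` below n" by (rule gr_cls_image)
  also have "\<dots> = cls S ` {z. z - x \<in> lower S n}"
  proof (intro equalityI subsetI)
    fix Y assume "Y \<in> (\<lambda>b. cls S (b + x)) ` below n"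
    then obtain b where "b \<in> below n" "Y = cls S (b + x)" by blast
    then show "Y \<in> cls S ` {z. z - x \<in> lower S n}"
      by (intro image_eqI[of _ _ "b + x"]) (auto intro: below_lower)
  next
    fix Y assume "Y \<in> cls S ` {z. z - x \<in> lower S n}"
    then obtain z b where "Y = cls S z" "b \<in> below n" "z - x - b \<in> rel_ideal S"
      by (auto simp: lower_def)
    then show "Y \<in> (\<lambda>b. cls S (b + x)) ` below n"
      by (intro image_eqI[of _ _ b]) (auto simp: cls_eq_iff algebra_simps)
  qed
  finally show ?thesis .
qed

lemma gr_cls_eq_iff: "gr_cls S n x = gr_cls S n y \<longleftrightarrow> x - y \<in> lower S n"
proof
  assume *: "gr_cls S n x = gr_cls S n y"
  have "cls S x \<in> gr_cls S n x" by (auto simp: gr_cls_eq intro!: below_lower)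
  then obtain z where "cls S x = cls S z" and z: "z - y \<in> lower S n"
    unfolding * unfolding gr_cls_eq by blast
  then have "x - z \<in> lower S n" by (auto simp: cls_eq_iff intro: lowerI[of _ 0])
  then show "x - y \<in> lower S n" using lower_add[OF _ z] by fastforce
next
  assume *: "x - y \<in> lower S n"
  have "z - x \<in> lower S n \<longleftrightarrow> z - y \<in> lower S n" for z
    using lower_add[of "z - x", OF _ *] lower_diff[of "z - y", OF _ *] by (auto simp: algebra_simps)
  then show "gr_cls S n x = gr_cls S n y" by (simp add: gr_cls_eq)
qed

lemma gr_cls_self: "cls S x \<in> gr_cls S n x"
  by (auto simp: gr_cls_eq intro!: below_lower)

lemma UN_gr_cls:
  assumes "\<And>z. z - x \<in> lower S n \<Longrightarrow> f (cls S z) = Y"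
  shows "(\<Union>X\<in>gr_cls S n x. f X) = Y"
  by (rule UN_constant_eq[OF gr_cls_self]) (auto simp: gr_cls_eq assms)

text \<open>The group $F^n/F^{n-1}$ of the algebra presented by \<open>S\<close>.\<close>

abbreviation gr_part :: "'g free set \<Rightarrow> nat \<Rightarrow> 'g free set set monoid" where
  "gr_part S \<equiv> gr_comp (presented_alg S) (word_filtration S)"

lemma gr_part_simps:
  "carrier (gr_part S n) = gr_cls S n ` below (Suc n)"
  "\<one>\<^bsub>gr_part S n\<^esub> = gr_cls S n 0"
  "gr_cls S n x \<otimes>\<^bsub>gr_part S n\<^esub> gr_cls S n y = gr_cls S n (x + y)"
proof -
  note defs = gr_comp_def A_FactGroup_def FactGroup_def RCOSETS_def
  show "carrier (gr_part S n) = gr_cls S n ` below (Suc n)"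
    by (auto simp: defs gr_cls_def a_r_coset_def r_coset_def word_filtration_eq)
  show "\<one>\<^bsub>gr_part S n\<^esub> = gr_cls S n 0"
    by (simp add: defs filt_pred_eq gr_cls_image)
  have "gr_cls S n x \<otimes>\<^bsub>gr_part S n\<^esub> gr_cls S n y = (\<Union>X\<in>gr_cls S n x. \<Union>Y\<in>gr_cls S n y. {X \<oplus>\<^bsub>presented_alg S\<^esub> Y})"
    by (simp add: defs set_mult_def)
  also have "\<dots> = gr_cls S n (x + y)"
  proof (intro equalityI subsetI)
    fix Z assume "Z \<in> (\<Union>X\<in>gr_cls S n x. \<Union>Y\<in>gr_cls S n y. {X \<oplus>\<^bsub>presented_alg S\<^esub> Y})"
    then obtain u v where "u - x \<in> lower S n" "v - y \<in> lower S n" "Z = cls S (u + v)"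
      by (auto simp: gr_cls_eq presented_alg_simps)
    then show "Z \<in> gr_cls S n (x + y)"
      using lower_add[of "u - x" S n "v - y"] by (auto simp: gr_cls_eq algebra_simps)
  next
    fix Z assume "Z \<in> gr_cls S n (x + y)"
    then obtain z where z: "z - (x + y) \<in> lower S n" "Z = cls S z" by (auto simp: gr_cls_eq)
    then have "cls S (z - y) \<in> gr_cls S n x" by (auto simp: gr_cls_eq algebra_simps)
    moreover have "Z = cls S (z - y) \<oplus>\<^bsub>presented_alg S\<^esub> cls S y"
      by (simp add: presented_alg_simps z)
    ultimately show "Z \<in> (\<Union>X\<in>gr_cls S n x. \<Union>Y\<in>gr_cls S n y. {X \<oplus>\<^bsub>presented_alg S\<^esub> Y})"
      using gr_cls_self by blast
  qed
  finally show "gr_cls S n x \<otimes>\<^bsub>gr_part S n\<^esub> gr_cls S n y = gr_cls S n (x + y)" .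
qed

lemma comm_monoid_gr_part: "comm_monoid (gr_part S n)"
  by (rule comm_monoidI) (auto simp: gr_part_simps ac_simps intro: below_add)

lemma finprod_gr_part:
  assumes "finite B" and "\<And>i. i \<in> B \<Longrightarrow> f i \<in> below (Suc n)"
  shows "finprod (gr_part S n) (\<lambda>i. gr_cls S n (f i)) B = gr_cls S n (sum f B)"
  using assms
proof (induction B rule: finite_induct)
  case empty
  interpret comm_monoid "gr_part S n" by (rule comm_monoid_gr_part)
  show ?case by (simp add: gr_part_simps)
next
  case (insert i B)
  interpret comm_monoid "gr_part S n" by (rule comm_monoid_gr_part)
  show ?case using insert
    by (subst finprod_insert) (auto simp: gr_part_simps Pi_iff)
qed

lemma gr_part_mult:
  assumes "x \<in> below (Suc m)" and "y \<in> below (Suc n)"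
  shows "gr_comp_mult (presented_alg S) (word_filtration S) m n (gr_cls S m x) (gr_cls S n y) = gr_cls S (m + n) (x * y)"
  unfolding gr_comp_mult_def rcoset_mult_def
proof (intro UN_gr_cls)
  fix u v assume u: "u - x \<in> lower S m" and v: "v - y \<in> lower S n"
  have "(u - x) * v + x * (v - y) \<in> lower S (m + n)"
  proof (rule lower_add)
    have "v - y \<in> lower S (Suc n)" by (rule lower_mono[OF v]) simp
    then have "v \<in> lower S (Suc n)" using lower_add[OF _ below_lower[OF assms(2)]] by fastforce
    then show "(u - x) * v \<in> lower S (m + n)" by (rule lower_mult[OF u])
    show "x * (v - y) \<in> lower S (m + n)" by (intro lower_mult' v below_lower assms)
  qed
  then have "gr_cls S (m + n) (u * v) = gr_cls S (m + n) (x * y)"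
    by (simp add: gr_cls_eq_iff algebra_simps)
  then show "filt_pred (presented_alg S) (word_filtration S) (m + n) +>\<^bsub>presented_alg S\<^esub>
      (cls S u \<otimes>\<^bsub>presented_alg S\<^esub> cls S v) = gr_cls S (m + n) (x * y)"
    by (simp add: gr_cls_def presented_alg_simps)
qed

text \<open>The family of the classes of the homogeneous components.  This is a homomorphism from the free algebra onto
  the associated graded algebra, through which the canonical homomorphism is defined.\<close>

definition symb :: "'g free set \<Rightarrow> 'g free \<Rightarrow> nat \<Rightarrow> 'g free set set" where
  "symb S x = (\<lambda>n. gr_cls S n (hcomp n x))"

text \<open>The associated graded algebra of the algebra presented by \<open>S\<close>.\<close>

abbreviation gr_presented :: "'g free set \<Rightarrow> (complex, nat \<Rightarrow> 'g free set set) module" where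
  "gr_presented S \<equiv> gr_alg (presented_alg S) (word_filtration S)"

lemma hcomp_below: "hcomp n x \<in> below (Suc n)"
  by (rule homog_below[OF hcomp_homog]) simp

lemma symb_add: "symb S x \<oplus>\<^bsub>gr_presented S\<^esub> symb S y = symb S (x + y)"
  by (simp add: gr_alg_def symb_def gr_part_simps hcomp_add)

lemma symb_mult: "symb S x \<otimes>\<^bsub>gr_presented S\<^esub> symb S y = symb S (x * y)"
proof -
  have "(symb S x \<otimes>\<^bsub>gr_presented S\<^esub> symb S y) n = symb S (x * y) n" for n
  proof -
    interpret comm_monoid "gr_part S n" by (rule comm_monoid_gr_part)
    have below: "hcomp i x * hcomp (n - i) y \<in> below (Suc n)" if "i \<le> n" for i
      using below_mult[OF hcomp_below[of i x] hcomp_below[of "n - i" y]] that by simp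
    have "(symb S x \<otimes>\<^bsub>gr_presented S\<^esub> symb S y) n = finprod (gr_part S n)
      (\<lambda>i. gr_comp_mult (presented_alg S) (word_filtration S) i (n - i) (symb S x i) (symb S y (n - i))) {..n}"
      by (simp add: gr_alg_def)
    also have "\<dots> = finprod (gr_part S n) (\<lambda>i. gr_cls S n (hcomp i x * hcomp (n - i) y)) {..n}"
      by (rule finprod_cong') (auto simp: symb_def gr_part_mult hcomp_below gr_part_simps below)
    also have "\<dots> = symb S (x * y) n"
      by (subst finprod_gr_part) (auto simp: below symb_def hcomp_mult)
    finally show ?thesis .
  qed
  then show ?thesis by blast
qed

lemma symb_incl: "x \<in> homog n \<Longrightarrow> symb S x = gr_incl (presented_alg S) (word_filtration S) n (cls S x)"
  by (rule ext) (auto simp: symb_def gr_incl_def hcomp_of_homog gr_part_simps gr_cls_def)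

lemma symb_one: "\<one>\<^bsub>gr_presented S\<^esub> = symb S 1"
  using symb_incl[of 1 0 S] by (simp add: gr_alg_def presented_alg_simps homog_def wlen_def zero_fword_def)

lemma symb_gen: "symb S (gen g) = gr_incl (presented_alg S) (word_filtration S) 1 (cls S (gen g))"
  by (rule symb_incl) (simp add: homog_def gen_def wlen_def)

lemma symb_scal: "c \<odot>\<^bsub>gr_presented S\<^esub> symb S x = symb S (scal c x)"
proof -
  have "(\<Union>X\<in>gr_cls S n y. filt_pred (presented_alg S) (word_filtration S) n +>\<^bsub>presented_alg S\<^esub>
      (c \<odot>\<^bsub>presented_alg S\<^esub> X)) = gr_cls S n (scal c y)" for n y
  proof (rule UN_gr_cls)
    fix z assume "z - y \<in> lower S n"
    then have "gr_cls S n (scal c z) = gr_cls S n (scal c y)"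
      using lower_scal[of "z - y"] by (simp add: gr_cls_eq_iff free.scale_right_diff_distrib)
    then show "filt_pred (presented_alg S) (word_filtration S) n +>\<^bsub>presented_alg S\<^esub>
        (c \<odot>\<^bsub>presented_alg S\<^esub> cls S z) = gr_cls S n (scal c y)"
      by (simp add: gr_cls_def presented_alg_simps)
  qed
  then show ?thesis by (simp add: gr_alg_def symb_def hcomp_scal)
qed

lemma symb_eq_iff: "symb S x = symb S y \<longleftrightarrow> (\<forall>n. hcomp n (x - y) \<in> lower S n)"
  by (auto simp: symb_def fun_eq_iff gr_cls_eq_iff hcomp_diff)

lemma symb_carrier: "symb S x \<in> carrier (gr_presented S)"
proof -
  obtain m where m: "x \<in> below m" using ex_below by blast
  have "hcomp n x = 0" if "n \<ge> m" for n
    by (rule hcomp_of_below[OF below_mono[OF m that]])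
  then have "{n. symb S x n \<noteq> gr_cls S n 0} \<subseteq> {..<m}"
    by (auto simp: symb_def not_less[symmetric])
  then have "finite {n. symb S x n \<noteq> gr_cls S n 0}"
    by (rule finite_subset) simp
  then show ?thesis
    by (auto simp: gr_alg_def gr_part_simps symb_def hcomp_below)
qed

text \<open>The components of a preimage are the leading parts of representatives of the finitely many nonzero classes.\<close>

lemma symb_surj:
  assumes "y \<in> carrier (gr_presented S)" shows "\<exists>x. symb S x = y"
proof -
  define N where "N = {n. y n \<noteq> gr_cls S n 0}"
  have N: "finite N" and "\<forall>n. \<exists>z\<in>below (Suc n). y n = gr_cls S n z"
    using assms by (auto simp: gr_alg_def gr_part_simps N_def)
  then obtain z where z: "\<And>n. z n \<in> below (Suc n)" "\<And>n. y n = gr_cls S n (z n)"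
    by metis
  define x where "x = (\<Sum>n\<in>N. hcomp n (z n))"
  have "symb S x n = y n" for n
  proof -
    have "hcomp n x = (if n \<in> N then hcomp n (z n) else 0)"
      using N by (simp add: x_def hcomp_sum hcomp_of_homog[OF hcomp_homog])
    moreover have "gr_cls S n (hcomp n (z n)) = y n"
      using lower_minus[OF below_lower[OF diff_hcomp_below[OF z(1)]]] by (simp add: z(2) gr_cls_eq_iff)
    ultimately show ?thesis by (auto simp: symb_def N_def)
  qed
  then show ?thesis by blast
qed

lemma gr_grading_eq: "gr_grading (presented_alg S) (word_filtration S) n = symb S ` homog n"
proof (intro equalityI subsetI)
  fix y assume "y \<in> gr_grading (presented_alg S) (word_filtration S) n"
  then have y: "y \<in> carrier (gr_presented S)" "\<And>k. k \<noteq> n \<Longrightarrow> y k = gr_cls S k 0"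
    by (auto simp: gr_grading_def gr_part_simps)
  obtain x where x: "symb S x = y" using symb_surj[OF y(1)] by blast
  have "symb S (hcomp n x) = y"
    using y(2) unfolding x[symmetric] by (intro ext) (auto simp: symb_def hcomp_of_homog[OF hcomp_homog])
  then show "y \<in> symb S ` homog n" using hcomp_homog by blast
next
  fix y assume "y \<in> symb S ` homog n"
  then show "y \<in> gr_grading (presented_alg S) (word_filtration S) n"
    by (auto simp: gr_grading_def gr_part_simps symb_carrier) (auto simp: symb_def hcomp_of_homog)
qed

section \<open>The canonical homomorphism\<close>

text \<open>The values on generators determine a homomorphism.  This uses only the compatibility with the operations, and
  no ring axioms in the target.\<close>

lemma cls_hom_unique:
  assumes f: "alg_hom (presented_alg K) (gr_presented S) f"
    and gen: "\<And>g. f (cls K (gen g)) = symb S (gen g)"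
  shows "f (cls K x) = symb S x"
proof -
  have hom: "f \<in> ring_hom (presented_alg K) (gr_presented S)"
    and scal: "\<And>c x. f (cls K (scal c x)) = c \<odot>\<^bsub>gr_presented S\<^esub> f (cls K x)"
    using f by (auto simp: alg_hom_def presented_alg_simps simp flip: presented_alg_simps(6))
  have add: "f (cls K (x + y)) = f (cls K x) \<oplus>\<^bsub>gr_presented S\<^esub> f (cls K y)"
    and mult: "f (cls K (x * y)) = f (cls K x) \<otimes>\<^bsub>gr_presented S\<^esub> f (cls K y)"
    and one: "f (cls K 1) = symb S 1" for x y
    using ring_hom_add[OF hom, of "cls K x" "cls K y"] ring_hom_mult[OF hom, of "cls K x" "cls K y"] ring_hom_one[OF hom]
    by (simp_all add: presented_alg_simps symb_one)
  show ?thesis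
  proof (induction x rule: free_induct)
    case (mon w)
    show ?case
    proof (induction w)
      case (Cons g w)
      then show ?case unfolding mon_Cons by (simp add: mult gen symb_mult)
    qed (simp add: one)
  qed (simp_all add: add scal symb_add symb_scal)
qed

text \<open>If \<open>K\<close> consists of homogeneous elements that are leading parts of consequences of \<open>S\<close>, and if conversely
  the leading part of every consequence of \<open>S\<close> follows from \<open>K\<close>, then \<open>K\<close> presents the associated
  graded algebra.\<close>

locale leading_relations =
  fixes K S :: "'g free set"
  assumes rel_homog: "x \<in> K \<Longrightarrow> \<exists>n. x \<in> homog n \<and> x \<in> lower S n"
    and leading: "x \<in> homog n \<Longrightarrow> x \<in> lower S n \<Longrightarrow> x \<in> rel_ideal K"
begin

lemma symb_eq_iff_cls_eq: "symb S x = symb S y \<longleftrightarrow> cls K x = cls K y"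
proof
  assume "symb S x = symb S y"
  then have *: "hcomp n (x - y) \<in> rel_ideal K" for n
    using leading[OF hcomp_homog] by (simp add: symb_eq_iff)
  obtain n where "x - y \<in> below n" using ex_below by blast
  then have "x - y = (\<Sum>i<n. hcomp i (x - y))" by (rule hcomp_expand)
  also have "\<dots> \<in> rel_ideal K" by (intro rel_ideal_sum *)
  finally show "cls K x = cls K y" by (simp add: cls_eq_iff)
next
  assume "cls K x = cls K y"
  then have "x - y \<in> rel_ideal K" by (simp add: cls_eq_iff)
  moreover have "rel_ideal K \<subseteq> {x. symb S x = symb S 0}"
  proof (rule rel_ideal_subset)
    show "K \<subseteq> {x. symb S x = symb S 0}"
    proof
      fix x assume "x \<in> K"
      then obtain n where "x \<in> homog n" "x \<in> lower S n" using rel_homog by blast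
      then show "x \<in> {x. symb S x = symb S 0}" by (auto simp: symb_eq_iff hcomp_of_homog intro: below_lower)
    qed
  next
    fix x y assume x: "x \<in> {x. symb S x = symb S 0}" 
    then show "y * x \<in> {x. symb S x = symb S 0}" "x * y \<in> {x. symb S x = symb S 0}"
      using symb_mult[of S y x] symb_mult[of S y 0] symb_mult[of S x y] symb_mult[of S 0 y] by simp_all
    assume "y \<in> {x. symb S x = symb S 0}"
    with x show "x + y \<in> {x. symb S x = symb S 0}"
      using symb_add[of S x y] symb_add[of S 0 0] by simp
  qed simp
  ultimately show "symb S x = symb S y" by (auto simp: symb_eq_iff)
qed

lemma graded_alg_iso_of_symb:
  assumes f: "\<And>x. f (cls K x) = symb S x"
  shows "graded_alg_iso (presented_alg K) (word_grading K)
    (gr_presented S) (gr_grading (presented_alg S) (word_filtration S)) f"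
  unfolding graded_alg_iso_def
proof (intro conjI allI)
  show "alg_hom (presented_alg K) (gr_presented S) f"
    unfolding alg_hom_def
    by (auto intro!: ring_hom_memI
        simp: presented_alg_simps f symb_carrier symb_add symb_mult symb_one symb_scal)
  show "bij_betw f (carrier (presented_alg K)) (carrier (gr_presented S))"
    unfolding bij_betw_def
  proof
    show "inj_on f (carrier (presented_alg K))"
      by (auto simp: inj_on_def presented_alg_simps f symb_eq_iff_cls_eq)
    show "f ` carrier (presented_alg K) = carrier (gr_presented S)"
      using symb_surj[of _ S] by (auto simp: presented_alg_simps f symb_carrier image_image)
  qed
  show "f ` word_grading K n = gr_grading (presented_alg S) (word_filtration S) n" for n
    by (simp add: word_grading_eq gr_grading_eq image_image f)
qed

lemma ex_symb_map:
  "\<exists>f \<in> extensional (carrier (presented_alg K)). \<forall>x. f (cls K x) = symb S x"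
proof
  let ?f = "restrict (\<lambda>X. symb S (SOME x. cls K x = X)) (carrier (presented_alg K))"
  show "?f \<in> extensional (carrier (presented_alg K))" by simp
  have "cls K (SOME y. cls K y = cls K x) = cls K x" for x
    by (rule someI) simp
  then show "\<forall>x. ?f (cls K x) = symb S x"
    by (simp add: presented_alg_simps symb_eq_iff_cls_eq)
qed

end


section \<open>The braiding given by R\<close>

text \<open>A pair of letters of different type is exchanged by \<open>R\<close>, a pair of letters of the same type is flipped.  For
  \<open>(Inl l, Inr \<alpha>)\<close> the coefficients are those of the inverse of \<open>R\<close> as given by C4.\<close>

fun braid_of :: "('a, 'b) rmat \<Rightarrow> 'a + 'b \<Rightarrow> 'a + 'b \<Rightarrow> 'a + 'b \<Rightarrow> 'a + 'b \<Rightarrow> complex" where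
  "braid_of R (Inr \<beta>) (Inl \<mu>) (Inl l) (Inr \<alpha>) = R l \<alpha> \<beta> \<mu>"
| "braid_of R (Inl l) (Inr \<alpha>) (Inr \<beta>) (Inl \<mu>) = R \<mu> \<alpha> \<beta> l"
| "braid_of R (Inl l) (Inl m) (Inl l') (Inl m') = kron l m' * kron m l'"
| "braid_of R (Inr \<alpha>) (Inr \<beta>) (Inr \<alpha>') (Inr \<beta>') = kron \<alpha> \<beta>' * kron \<beta> \<alpha>'"
| "braid_of R _ _ _ _ = 0"

lemma sum_sum_type: "(\<Sum>x\<in>UNIV. f x) = (\<Sum>l\<in>UNIV. f (Inl l)) + (\<Sum>\<alpha>\<in>UNIV. f (Inr \<alpha>))"
  for f :: "'a::finite + 'b::finite \<Rightarrow> 'c::comm_monoid_add"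
  by (simp add: sum.Plus flip: UNIV_Plus_UNIV)

lemma kron_sum_type [simp]:
  "kron (Inl l) (Inl m) = kron l m" "kron (Inr a) (Inr b) = kron a b"
  "kron (Inl l) (Inr b) = 0" "kron (Inr a) (Inl m) = 0"
  by (simp_all add: kron_def)

lemma kron_cnj: "cnj (kron i j) = kron i j"
  by (simp add: kron_def)

lemma kron_commute: "kron i j = kron j i"
  by (simp add: kron_def)

lemma sum_kron:
  fixes f :: "'i::finite \<Rightarrow> complex"
  shows "(\<Sum>i\<in>UNIV. f i * kron i j) = f j" "(\<Sum>i\<in>UNIV. f i * kron j i) = f j"
    "(\<Sum>i\<in>UNIV. kron i j * f i) = f j" "(\<Sum>i\<in>UNIV. kron j i * f i) = f j"
  by (simp_all add: kron_def if_distrib[of "\<lambda>x. _ * x"] if_distrib[of "\<lambda>x. x * _"] cong: if_cong)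

lemma kron_mult: "kron i j * x = (if i = j then x else 0)" "x * kron i j = (if i = j then x else 0)"
  by (simp_all add: kron_def)

lemma if_mult: "(if P then x else 0) * y = (if P then x * y else 0)" "y * (if P then x else 0) = (if P then y * x else 0)"
  for x y :: complex
  by simp_all

lemma sum_if: "(\<Sum>i\<in>A. if P then f i else 0) = (if P then \<Sum>i\<in>A. f i else 0)"
  by simp

context
  fixes R :: "('a::finite, 'b::finite) rmat"
  assumes C1: "cond_C1 R" and C2: "cond_C2 R" and C3: "cond_C3 R" and C4: "cond_C4 R"
begin

text \<open>C4 gives two left inverses of the matrix with entries \<open>R l \<beta> \<alpha> \<mu>\<close>, with rows \<open>(l, \<beta>)\<close> and columns
  \<open>(\<alpha>, \<mu>)\<close>.  By the complex conjugate of C1 this matrix has a right inverse, so the two coincide.\<close>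

lemma R_rotate: "R l \<gamma> \<beta> \<nu> = R \<nu> \<beta> \<gamma> l"
proof -
  have right: "(\<Sum>\<alpha>\<in>UNIV. \<Sum>\<mu>\<in>UNIV. R m b \<alpha> \<mu> * bar R \<mu> \<alpha> g n) = kron m n * kron b g" for m b g n
  proof -
    have "cnj (\<Sum>\<mu>\<in>UNIV. \<Sum>\<alpha>\<in>UNIV. bar R m b \<alpha> \<mu> * R \<mu> \<alpha> g n) = cnj (kron m n * kron b g)"
      using C1 by (simp add: cond_C1_def)
    then show ?thesis
      by (subst sum.swap) (simp add: bar_def kron_cnj)
  qed
  have C4a: "(\<Sum>l\<in>UNIV. \<Sum>\<beta>\<in>UNIV. R l \<gamma> \<beta> \<nu> * R l \<beta> \<alpha> \<mu>) = kron \<gamma> \<alpha> * kron \<mu> \<nu>"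
    and C4b: "(\<Sum>l\<in>UNIV. \<Sum>\<beta>\<in>UNIV. R \<nu> \<beta> \<gamma> l * R l \<beta> \<alpha> \<mu>) = kron \<gamma> \<alpha> * kron \<mu> \<nu>" for \<alpha> \<gamma> \<mu> \<nu>
    using C4 sum.swap[of "\<lambda>l \<beta>. R \<nu> \<beta> \<gamma> l * R l \<beta> \<alpha> \<mu>" UNIV UNIV] by (simp_all add: cond_C4_def kron_commute[of \<nu>] mult.commute[of "kron \<gamma> _"])
  have left: "L l \<beta> = bar R \<nu> \<gamma> \<beta> l"
    if L: "\<And>\<alpha> \<mu>. (\<Sum>l\<in>UNIV. \<Sum>\<beta>\<in>UNIV. L l \<beta> * R l \<beta> \<alpha> \<mu>) = kron \<gamma> \<alpha> * kron \<mu> \<nu>" for L l \<beta>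
  proof -
    have "L l \<beta> = (\<Sum>m\<in>UNIV. \<Sum>b\<in>UNIV. L m b * (kron m l * kron b \<beta>))"
      by (simp add: sum_kron flip: mult.assoc)
    also have "\<dots> = (\<Sum>m\<in>UNIV. \<Sum>b\<in>UNIV. \<Sum>\<alpha>\<in>UNIV. \<Sum>\<mu>\<in>UNIV. L m b * R m b \<alpha> \<mu> * bar R \<mu> \<alpha> \<beta> l)"
      by (simp add: sum_distrib_left mult.assoc flip: right)
    also have "\<dots> = (\<Sum>\<alpha>\<in>UNIV. \<Sum>m\<in>UNIV. \<Sum>b\<in>UNIV. \<Sum>\<mu>\<in>UNIV. L m b * R m b \<alpha> \<mu> * bar R \<mu> \<alpha> \<beta> l)"
      by (rule sum_swap2)
    also have "\<dots> = (\<Sum>\<alpha>\<in>UNIV. \<Sum>\<mu>\<in>UNIV. \<Sum>m\<in>UNIV. \<Sum>b\<in>UNIV. L m b * R m b \<alpha> \<mu> * bar R \<mu> \<alpha> \<beta> l)"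
      by (rule sum.cong[OF refl], rule sum_swap2)
    also have "\<dots> = (\<Sum>\<alpha>\<in>UNIV. \<Sum>\<mu>\<in>UNIV. kron \<gamma> \<alpha> * kron \<mu> \<nu> * bar R \<mu> \<alpha> \<beta> l)"
      by (simp flip: L add: sum_distrib_right)
    also have "\<dots> = bar R \<nu> \<gamma> \<beta> l"
      by (simp add: sum_kron mult.assoc flip: sum_distrib_left)
    finally show ?thesis .
  qed
  have "R l \<gamma> \<beta> \<nu> = bar R \<nu> \<gamma> \<beta> l"
    by (rule left[of "\<lambda>l \<beta>. R l \<gamma> \<beta> \<nu>"]) (rule C4a)
  also have "\<dots> = R \<nu> \<beta> \<gamma> l"
    by (rule left[of "\<lambda>l \<beta>. R \<nu> \<beta> \<gamma> l", symmetric]) (rule C4b)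
  finally show ?thesis .
qed

lemma C2_eq: "(\<Sum>\<rho>\<in>UNIV. R \<rho> \<beta> \<delta> \<mu> * R l \<alpha> \<gamma> \<rho>) = (\<Sum>\<rho>\<in>UNIV. R \<rho> \<alpha> \<gamma> \<mu> * R l \<beta> \<delta> \<rho>)"
  using C2 by (simp add: cond_C2_def mult.commute[of "R _ \<beta> \<delta> \<mu>"] mult.commute[of "R _ \<alpha> \<gamma> \<mu>"])

lemma C3_eq: "(\<Sum>\<gamma>\<in>UNIV. R l \<alpha> \<gamma> \<nu> * R \<mu> \<gamma> \<beta> \<rho>) = (\<Sum>\<gamma>\<in>UNIV. R \<mu> \<alpha> \<gamma> \<rho> * R l \<gamma> \<beta> \<nu>)"
  using C3 by (simp add: cond_C3_def)

text \<open>C3 with the indices of some of its factors rotated.\<close>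

lemma C3_rotate1: "(\<Sum>\<gamma>\<in>UNIV. R \<nu> \<gamma> \<alpha> l * R \<mu> \<gamma> \<beta> \<rho>) = (\<Sum>\<gamma>\<in>UNIV. R \<mu> \<alpha> \<gamma> \<rho> * R \<nu> \<beta> \<gamma> l)"
  using C3_eq[of l \<alpha> \<nu> \<mu> \<beta> \<rho>] by (simp only: R_rotate[of l _ _ \<nu>])

lemma C3_rotate2: "(\<Sum>\<gamma>\<in>UNIV. R \<nu> \<gamma> \<alpha> l * R \<rho> \<beta> \<gamma> \<mu>) = (\<Sum>\<gamma>\<in>UNIV. R \<rho> \<gamma> \<alpha> \<mu> * R \<nu> \<beta> \<gamma> l)"
  using C3_eq[of l \<alpha> \<nu> \<mu> \<beta> \<rho>] by (simp only: R_rotate[of l _ _ \<nu>] R_rotate[of \<mu> _ _ \<rho>])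

lemmas kron_simps = sum_sum_type kron_mult if_mult sum_if

lemma braid_of_rotate: "braid_of R g k h b = braid_of R h g b k"
  by (cases g; cases k; cases h; cases b) (auto simp: kron_commute intro: R_rotate)

lemma braid_of_trace: "(\<Sum>a\<in>UNIV. braid_of R h g a a) = kron h g"
  by (cases h; cases g) (simp_all add: sum_sum_type sum_kron)

lemma braid_of_involutive:
  "(\<Sum>a\<in>UNIV. \<Sum>b\<in>UNIV. braid_of R h g a b * braid_of R a b c d) = kron h c * kron g d"
proof -
  have a: "(\<Sum>l\<in>UNIV. \<Sum>\<alpha>\<in>UNIV. R l \<alpha> \<beta> \<mu> * R m \<alpha> \<gamma> l) = kron m \<mu> * kron \<gamma> \<beta>" for \<beta> \<mu> m \<gamma>
  proof -
    have "(\<Sum>l\<in>UNIV. \<Sum>\<alpha>\<in>UNIV. R l \<alpha> \<beta> \<mu> * R m \<alpha> \<gamma> l) = (\<Sum>\<alpha>\<in>UNIV. \<Sum>l\<in>UNIV. R m \<alpha> \<gamma> l * R l \<alpha> \<beta> \<mu>)"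
      by (subst sum.swap) (simp only: mult.commute)
    with C4 show ?thesis by (simp add: cond_C4_def)
  qed
  have b: "(\<Sum>\<beta>\<in>UNIV. \<Sum>\<mu>\<in>UNIV. R \<mu> \<alpha> \<beta> l * R m \<gamma> \<beta> \<mu>) = kron \<alpha> \<gamma> * kron m l" for \<alpha> l m \<gamma>
  proof -
    have "(\<Sum>\<beta>\<in>UNIV. \<Sum>\<mu>\<in>UNIV. R \<mu> \<alpha> \<beta> l * R m \<gamma> \<beta> \<mu>) = (\<Sum>\<mu>\<in>UNIV. \<Sum>\<beta>\<in>UNIV. R \<mu> \<alpha> \<beta> l * R \<mu> \<beta> \<gamma> m)"
      by (subst sum.swap) (simp only: R_rotate[of m])
    with C4 show ?thesis by (simp add: cond_C4_def)
  qed
  show ?thesis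
    by (cases h; cases g; cases c; cases d) (simp_all add: kron_simps a b, auto simp: kron_def)
qed

text \<open>The braid relation is trivial on words with letters of one type only.  Words with two letters in \<open>'a\<close> lead to C3,
  words with two letters in \<open>'b\<close> to C2.\<close>

lemma braid_of_braid: 
   "(\<Sum>p\<in>UNIV. \<Sum>q\<in>UNIV. \<Sum>r\<in>UNIV. braid_of R g k p q * braid_of R h p a r * braid_of R r q b c) =
      (\<Sum>p\<in>UNIV. \<Sum>q\<in>UNIV. \<Sum>r\<in>UNIV. braid_of R h g p q * braid_of R q k r c * braid_of R p r a b)"
  by (cases h; cases g; cases k; cases a; cases b; cases c)
     (simp_all add: kron_simps, auto simp: kron_def intro: C2_eq C3_eq C3_rotate1 C3_rotate2)

lemma braiding_braid_of: "braiding (braid_of R)"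
  by (rule braiding.intro braid_of_involutive braid_of_rotate braid_of_braid braid_of_trace)+

interpretation braiding "braid_of R"
  by (rule braiding_braid_of)

text \<open>The given relations are those for the pairs of letters that are not of the form \<open>(Inl l, Inr \<alpha>)\<close>.\<close>

definition rel_pairs :: "(('a + 'b) \<times> ('a + 'b)) set" where
  "rel_pairs = {(Inl l, Inl m) |l m. True} \<union> {(Inr \<alpha>, Inr \<beta>) |\<alpha> \<beta>. True} \<union> {(Inr \<beta>, Inl m) |\<beta> m. True}"

lemma br_braid_of:
  "br f (Inl l) (Inl m) = f (Inl m) (Inl l)" "br f (Inr \<alpha>) (Inr \<beta>) = f (Inr \<beta>) (Inr \<alpha>)"
  "br f (Inr \<beta>) (Inl m) = (\<Sum>l\<in>UNIV. \<Sum>\<alpha>\<in>UNIV. scal (R l \<alpha> \<beta> m) (f (Inl l) (Inr \<alpha>)))"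
  "br f (Inl l) (Inr \<alpha>) = (\<Sum>\<beta>\<in>UNIV. \<Sum>m\<in>UNIV. scal (R m \<alpha> \<beta> l) (f (Inr \<beta>) (Inl m)))"
  by (simp_all add: br_def sum_sum_type scal_kron_sum scal_kron_sum(2)[where d = "\<lambda>_. 1", simplified])

lemma image_rel_pairs:
  "(\<lambda>(h, g). f h g) ` rel_pairs =
     {f (Inl l) (Inl m) |l m. True} \<union> {f (Inr \<alpha>) (Inr \<beta>) |\<alpha> \<beta>. True} \<union> {f (Inr \<beta>) (Inl m) |\<beta> m. True}"
  unfolding rel_pairs_def by (force simp: image_Un)

lemma koszul_rels_eq: "koszul_rels R = (\<lambda>(h, g). ext_rel h g) ` rel_pairs"
  by (simp add: image_rel_pairs koszul_rels_def ext_rel_def br_braid_of)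

lemma clifford_rels_eq: "clifford_rels R = (\<lambda>(h, g). cliff_rel h g) ` rel_pairs"
  by (simp add: image_rel_pairs clifford_rels_def cliff_rel_def ext_rel_def br_braid_of)

text \<open>By involutivity of the braiding, the relation for \<open>(Inl l, Inr \<alpha>)\<close> is a combination of those for the pairs
  \<open>(Inr \<beta>, Inl m)\<close>.\<close>

lemma ext_rel_koszul: "ext_rel h g \<in> rel_ideal (koszul_rels R)"
proof -
  have given: "ext_rel h g \<in> rel_ideal (koszul_rels R)" if "(h, g) \<in> rel_pairs" for h g
    using that by (intro rel_ideal_base) (force simp: koszul_rels_eq)
  have "ext_rel (Inl l) (Inr \<alpha>) \<in> rel_ideal (koszul_rels R)" for l \<alpha>
  proof -
    have "br ext_rel (Inl l) (Inr \<alpha>) \<in> rel_ideal (koszul_rels R)"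
      unfolding br_braid_of by (intro rel_ideal_sum rel_ideal_scal given) (simp add: rel_pairs_def)
    then show ?thesis by (simp only: br_ext_rel)
  qed
  then show ?thesis
    by (cases h; cases g) (auto intro: given simp: rel_pairs_def)
qed

lemma rel_ideal_koszul: "rel_ideal (koszul_rels R) = ext_ideal"
proof
  show "ext_ideal \<subseteq> rel_ideal (koszul_rels R)"
    by (rule rel_ideal_subset)
       (auto intro: ext_rel_koszul rel_ideal_add rel_ideal_lmult rel_ideal_rmult)
  show "rel_ideal (koszul_rels R) \<subseteq> ext_ideal"
    by (rule rel_ideal_mono) (auto simp: koszul_rels_eq)
qed

lemma leading_relations_koszul: "leading_relations (koszul_rels R) (clifford_rels R)"
proof
  fix x assume "x \<in> koszul_rels R"
  then obtain h g where x: "x = ext_rel h g" and "(h, g) \<in> rel_pairs"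
    by (auto simp: koszul_rels_eq)
  then have "cliff_rel h g \<in> rel_ideal (clifford_rels R)"
    by (intro rel_ideal_base) (force simp: clifford_rels_eq)
  moreover have "(1 :: ('a + 'b) free) \<in> below 2"
    using mon_below[of "[]" 2] by simp
  ultimately have "x \<in> lower (clifford_rels R) 2"
    unfolding x cliff_rel_def by (rule lowerI[OF _ below_scal])
  then show "\<exists>n. x \<in> homog n \<and> x \<in> lower (clifford_rels R) n"
    using ext_rel_homog x by blast
next
  fix x :: "('a + 'b) free" and n
  assume x: "x \<in> homog n" and "x \<in> lower (clifford_rels R) n"
  then obtain b where b: "b \<in> below n" and "x - b \<in> rel_ideal (clifford_rels R)"
    by (auto simp: lower_def)
  then have "x - b \<in> rel_ideal (range (\<lambda>(h, g). cliff_rel h g))"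
    using rel_ideal_mono[of "clifford_rels R" "range (\<lambda>(h, g). cliff_rel h g)"] by (auto simp: clifford_rels_eq)
  then have "x \<in> ext_ideal"
    by (rule leading_part_cliff_ideal[OF _ x b]) (rule hcomp_rel_ideal, auto intro: ext_rel_homog)
  then show "x \<in> rel_ideal (koszul_rels R)"
    by (simp only: rel_ideal_koszul)
qed

end

section \<open>The canonical homomorphism is an isomorphism\<close>

theorem proposition4p4:
  fixes R :: "('a::finite, 'b::finite) rmat"
  assumes "cond_C1 R" and "cond_C2 R" and "cond_C3 R" and "cond_C4 R"
  shows "(\<exists>!f. f \<in> extensional (carrier (koszul_dual R)) \<and> is_can R f) \<and>
         (\<forall>can. is_can R can \<longrightarrow>
            graded_alg_iso (koszul_dual R) (koszul_grading R)
                           (gr_clifford R) (gr_clifford_grading R) can)"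
proof -
  let ?K = "koszul_rels R" and ?S = "clifford_rels R"
  interpret leading_relations ?K ?S
    using assms by (rule leading_relations_koszul)
  note defs = koszul_dual_def koszul_grading_def gr_clifford_def gr_clifford_grading_def clifford_def clifford_filt_def
  have is_can: "is_can R f \<longleftrightarrow> (\<forall>x. f (cls ?K x) = symb ?S x)" for f
  proof
    assume "is_can R f"
    then show "\<forall>x. f (cls ?K x) = symb ?S x"
      using cls_hom_unique[of ?K ?S f] by (auto simp: is_can_def defs symb_gen)
  next
    assume *: "\<forall>x. f (cls ?K x) = symb ?S x"
    then show "is_can R f"
      using graded_alg_iso_of_symb[of f] by (auto simp: is_can_def graded_alg_iso_def defs symb_gen)
  qed
  show ?thesis
  proof (intro conjI allI impI)
    show "\<exists>!f. f \<in> extensional (carrier (koszul_dual R)) \<and> is_can R f"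
    proof (rule ex_ex1I)
      show "\<exists>f. f \<in> extensional (carrier (koszul_dual R)) \<and> is_can R f"
        using ex_symb_map by (auto simp: is_can defs)
      fix f f'
      assume "f \<in> extensional (carrier (koszul_dual R)) \<and> is_can R f"
        and "f' \<in> extensional (carrier (koszul_dual R)) \<and> is_can R f'"
      then show "f = f'"
        by (intro extensionalityI[of f "carrier (koszul_dual R)" f']) (auto simp: is_can koszul_dual_def presented_alg_simps)
    qed
  next
    fix can assume "is_can R can"
    then show "graded_alg_iso (koszul_dual R) (koszul_grading R) (gr_clifford R) (gr_clifford_grading R) can"
      using graded_alg_iso_of_symb[of can] by (simp add: is_can defs)
  qed
qed

end
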